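(* Let $n\ge 1$ and let $G$ be a graph consisting of $2n+2$ vertices $x_1,\ldots,x_{2n+2}$ and $2n+2$ edges such that $2n+1$ of the edges form a cycle (on $2n+1$ of the vertices) and the remaining edge connects the remaining vertex to a vertex of the cycle. Let $I = I(G)\subseteq K[x_1,\ldots,x_{2n+2}]$ be the edge ideal of $G$. For every integer $t\ge 1$, let $(D(t))$ be the ideal generated by $$D(t) = \{x^{\underline{a}} \mid \deg(x^{\underline{a}}) < 2t \text{ and } w_{V'}(x^{\underline{a}}) \ge t \text{ for all minimal vertex covers } V' \text{ of } G\}.$$ Then $I^{(t)} = I^t + (D(t))$.
   Context: $K$ is an algebraically closed field; vertices of $G$ are identified with the variables of the polynomial ring. The edge ideal $I(G)$ of a simple graph $G$ is the ideal generated by all products $x_ix_j$ with $\{x_i,x_j\}$ an edge of $G$. The $m$th symbolic power of an ideal $I$ of a polynomial ring $S$ is $I^{(m)} = S\cap\bigcap_{P\in \mathrm{Ass}(I)} I^m S_P$. A vertex cover of $G$ is a set $V'$ of vertices meeting every edge; it is minimal if it is minimal with respect to inclusion. For a set $V'$ of vertices and a monomial $x^{\underline{a}} = \prod_i x_i^{a_i}$, the vertex weight is $w_{V'}(x^{\underline{a}}) = \sum_{x_i\in V'} a_i$. *)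

theory Defs
  imports
    "HOL-Algebra.Ideal_Product"
    "HOL-Library.Poly_Mapping"
    "HOL-Computational_Algebra.Polynomial"
begin

section \<open>Simple graphs\<close>

text \<open>A graph is given by its vertex set and the set of its edges, which are two-element
  sets of vertices.\<close>

definition simple_graph :: "'v set \<Rightarrow> 'v set set \<Rightarrow> bool" where
  "simple_graph V E \<longleftrightarrow> finite V \<and> (\<forall>e\<in>E. e \<subseteq> V \<and> card e = 2)"

text \<open>The edges in \<open>C\<close> form a cycle on the vertices in \<open>W\<close>: for some enumeration
  \<open>x\<^sub>0, \<dots>, x\<^sub>k\<^sub>-\<^sub>1\<close> of \<open>W\<close> without repetitions, \<open>k \<ge> 3\<close>, they are the sets
  \<open>{x\<^sub>i, x\<^sub>i\<^sub>+\<^sub>1}\<close>, with indices modulo \<open>k\<close>.\<close>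

definition forms_cycle :: "'v set set \<Rightarrow> 'v set \<Rightarrow> bool" where
  "forms_cycle C W \<longleftrightarrow>
     (\<exists>xs. distinct xs \<and> length xs \<ge> 3 \<and> set xs = W \<and>
        C = {{xs ! i, xs ! (Suc i mod length xs)} | i. i < length xs})"

definition vertex_cover :: "'v set \<Rightarrow> 'v set set \<Rightarrow> 'v set \<Rightarrow> bool" where
  "vertex_cover V E W \<longleftrightarrow> W \<subseteq> V \<and> (\<forall>e\<in>E. e \<inter> W \<noteq> {})"

definition minimal_vertex_cover :: "'v set \<Rightarrow> 'v set set \<Rightarrow> 'v set \<Rightarrow> bool" where
  "minimal_vertex_cover V E W \<longleftrightarrow>
     vertex_cover V E W \<and> (\<forall>W'. W' \<subset> W \<longrightarrow> \<not> vertex_cover V E W')"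


section \<open>Polynomial rings\<close>

text \<open>A monomial is identified with its exponent vector, a finitely supported function
  \<open>'v \<Rightarrow>\<^sub>0 nat\<close>. The type \<open>('v \<Rightarrow>\<^sub>0 nat) \<Rightarrow>\<^sub>0 'k\<close> with its (convolution) product is the ring
  of polynomials with coefficients in \<open>'k\<close> whose variables are all the elements of \<open>'v\<close>;
  \<open>poly_ring V\<close> is its subring \<open>K[V]\<close> of the polynomials in the variables from \<open>V\<close> only.\<close>

definition poly_ring :: "'v set \<Rightarrow> (('v \<Rightarrow>\<^sub>0 nat) \<Rightarrow>\<^sub>0 'k::comm_ring_1) ring" where
  "poly_ring V =
     \<lparr> carrier = {p. \<forall>a\<in>Poly_Mapping.keys p. Poly_Mapping.keys a \<subseteq> V},
       monoid.mult = (*), one = 1, zero = 0, add = (+) \<rparr>"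

definition monomial :: "('v \<Rightarrow>\<^sub>0 nat) \<Rightarrow> (('v \<Rightarrow>\<^sub>0 nat) \<Rightarrow>\<^sub>0 'k::comm_ring_1)" where
  "monomial a = Poly_Mapping.single a 1"

definition var :: "'v \<Rightarrow> (('v \<Rightarrow>\<^sub>0 nat) \<Rightarrow>\<^sub>0 'k::comm_ring_1)" where
  "var v = monomial (Poly_Mapping.single v 1)"

definition total_deg :: "('v \<Rightarrow>\<^sub>0 nat) \<Rightarrow> nat" where
  "total_deg a = (\<Sum>v\<in>Poly_Mapping.keys a. Poly_Mapping.lookup a v)"

definition vertex_weight :: "'v set \<Rightarrow> ('v \<Rightarrow>\<^sub>0 nat) \<Rightarrow> nat" where
  "vertex_weight W a = (\<Sum>v\<in>W. Poly_Mapping.lookup a v)"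

definition edge_ideal :: "'v set \<Rightarrow> 'v set set \<Rightarrow> (('v \<Rightarrow>\<^sub>0 nat) \<Rightarrow>\<^sub>0 'k::comm_ring_1) set" where
  "edge_ideal V E = Idl\<^bsub>poly_ring V\<^esub> {var u * var v | u v. {u, v} \<in> E}"

definition low_deg_monomials ::
    "'v set \<Rightarrow> 'v set set \<Rightarrow> nat \<Rightarrow> (('v \<Rightarrow>\<^sub>0 nat) \<Rightarrow>\<^sub>0 'k::comm_ring_1) set" where
  "low_deg_monomials V E t =
     {monomial a | a. Poly_Mapping.keys a \<subseteq> V \<and> total_deg a < 2 * t \<and>
        (\<forall>W. minimal_vertex_cover V E W \<longrightarrow> vertex_weight W a \<ge> t)}"


section \<open>Symbolic powers\<close>

text \<open>The elements of \<open>Ass(I)\<close>, i.e. the associated primes of the module \<open>R/I\<close>: those prime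
  ideals that are the annihilator of a residue class \<open>f + I\<close>.\<close>

definition associated_primes :: "('a, 'b) ring_scheme \<Rightarrow> 'a set \<Rightarrow> 'a set set" where
  "associated_primes R I =
     {P. primeideal P R \<and> (\<exists>f\<in>carrier R. P = {g \<in> carrier R. g \<otimes>\<^bsub>R\<^esub> f \<in> I})}"

text \<open>The fraction \<open>a/s\<close> in the localization \<open>R\<^sub>P\<close> at a prime ideal \<open>P\<close>, for \<open>a \<in> R\<close> and
  \<open>s \<in> R - P\<close>: the class of \<open>(a, s)\<close> under the usual equivalence relation, for which
  \<open>(a, s) ~ (b, u)\<close> iff \<open>q(au - bs) = 0\<close> for some \<open>q \<in> R - P\<close>.\<close>

definition loc_frac :: "('a, 'b) ring_scheme \<Rightarrow> 'a set \<Rightarrow> 'a \<Rightarrow> 'a \<Rightarrow> ('a \<times> 'a) set" where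
  "loc_frac R P a s =
     {(b, u). b \<in> carrier R \<and> u \<in> carrier R - P \<and>
        (\<exists>q \<in> carrier R - P. q \<otimes>\<^bsub>R\<^esub> ((a \<otimes>\<^bsub>R\<^esub> u) \<ominus>\<^bsub>R\<^esub> (b \<otimes>\<^bsub>R\<^esub> s)) = \<zero>\<^bsub>R\<^esub>)}"

text \<open>The ideal \<open>J R\<^sub>P\<close> of \<open>R\<^sub>P\<close>, for an ideal \<open>J\<close> of \<open>R\<close>.\<close>

definition loc_ideal :: "('a, 'b) ring_scheme \<Rightarrow> 'a set \<Rightarrow> 'a set \<Rightarrow> ('a \<times> 'a) set set" where
  "loc_ideal R P J = {loc_frac R P a s | a s. a \<in> J \<and> s \<in> carrier R - P}"

text \<open>The symbolic power \<open>R \<inter> \<Inter>{I\<^sup>m R\<^sub>P | P \<in> Ass(I)}\<close>, where an element \<open>f\<close> of \<open>R\<close> is regarded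
  as the element \<open>f/1\<close> of each \<open>R\<^sub>P\<close>. The power \<open>I\<^sup>m\<close> is taken in the monoid of ideals of \<open>R\<close>.\<close>

definition symbolic_power :: "('a, 'b) ring_scheme \<Rightarrow> 'a set \<Rightarrow> nat \<Rightarrow> 'a set" where
  "symbolic_power R I m =
     {f \<in> carrier R. \<forall>P \<in> associated_primes R I.
        loc_frac R P f \<one>\<^bsub>R\<^esub> \<in> loc_ideal R P (I [^]\<^bsub>ideals_set R\<^esub> m)}"

end

theory Submission
  imports Defs
begin

text \<open>Every associated prime of \<open>I\<close> is generated by the variables of a minimal vertex cover, and the
  powers of such primes are primary. Hence \<open>I\<^sup>(\<^sup>t\<^sup>)\<close> is spanned by the monomials that weigh at least
  \<open>t\<close> on every cover, and it remains to see that such a monomial of degree at least \<open>2 t\<close> is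
  divisible by a product of \<open>t\<close> edges. An edge can be split off, lowering \<open>t\<close> by one, unless some cover
  of weight \<open>t\<close> contains both its ends. The pendant edge never lies in such a cover, and neither does an
  edge ending in a leaf of the graph induced on the support of the monomial; this settles paths.
  On the odd cycle, a cover of weight at most \<open>t\<close> contains both ends of some edge because of parity, and
  the degree bound allows to delete this edge without creating lighter covers, leaving a path.\<close>

section \<open>Packing edges into monomials\<close>

text \<open>The packing lemmas are min-max statements: the least weight of a cover against the
  number of edges that fit into a monomial. On paths the two agree. On a cycle of 2n+1 vertices with
  all exponents 1 they do not: every cover weighs at least n+1, but a product of n+1 edges would
  have degree 2n+2. This monomial lies in I^(n+1) as a symbolic power but not in the ordinary power,
  so D(n+1) has to supply it, and no packing argument can avoid the degree bound. On the algebraic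
  side all ideals become sets of exponents. Ideal theory then enters at two points only: to see
  which covers belong to associated primes, and to cancel a factor outside such a prime. The second
  rests on the fact that terms of least weight survive in a product.\<close>

abbreviation "lookup \<equiv> Poly_Mapping.lookup"
abbreviation "single \<equiv> Poly_Mapping.single"
abbreviation "keys \<equiv> Poly_Mapping.keys"

text \<open>The exponents of monomials divisible by a product of \<open>t\<close> edges. Starting
  from \<open>UNIV\<close> admits any cofactor, so the set is closed under multiplication by
  monomials.\<close>

primrec edge_pow :: "'v set set \<Rightarrow> nat \<Rightarrow> ('v \<Rightarrow>\<^sub>0 nat) set" where
  "edge_pow E 0 = UNIV"
| "edge_pow E (Suc t) = {single x 1 + single z 1 + b | x z b.
     {x, z} \<in> E \<and> b \<in> edge_pow E t}"

text \<open>All covers are tested rather than the minimal ones because the exchanges below produce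
  covers that may fail to be minimal; \<open>heavy_iff_minimal\<close> shows that the condition is
  the same.\<close>

definition heavy :: "'v set \<Rightarrow> 'v set set \<Rightarrow> nat \<Rightarrow> ('v \<Rightarrow>\<^sub>0 nat) set" where
  "heavy V E t = {a. \<forall>S. vertex_cover V E S \<longrightarrow> t \<le> vertex_weight S a}"

lemma vertex_weight_add: "vertex_weight S (a + b) = vertex_weight S a + vertex_weight S b"
  by (simp add: vertex_weight_def lookup_add sum.distrib)

lemma vertex_weight_single:
  assumes "finite S"
  shows "vertex_weight S (single x k) = (if x \<in> S then k else 0)"
proof -
  have "vertex_weight S (single x k) = (\<Sum>v\<in>S. if x = v then k else 0)"
    unfolding vertex_weight_def by (rule sum.cong) (auto simp: lookup_single when_def)
  then show ?thesis using assms by simp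
qed

lemma vertex_weight_mono:
  assumes "finite T" "S \<subseteq> T"
  shows "vertex_weight S a \<le> vertex_weight T a"
  unfolding vertex_weight_def by (rule sum_mono2) (use assms in auto)

lemma vertex_weight_union:
  assumes "finite S" "finite T" "S \<inter> T = {}"
  shows "vertex_weight (S \<union> T) a = vertex_weight S a + vertex_weight T a"
  unfolding vertex_weight_def by (rule sum.union_disjoint) (use assms in auto)

lemma vertex_weight_eq_0:
  assumes "\<forall>v\<in>S. lookup a v = 0"
  shows "vertex_weight S a = 0"
  unfolding vertex_weight_def by (rule sum.neutral) (use assms in auto)

lemma split_single:
  fixes a :: "'v \<Rightarrow>\<^sub>0 nat"
  assumes "lookup a x \<ge> 1"
  obtains b where "a = single x 1 + b"
proof
  show "a = single x 1 + (a - single x 1)"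
    by (rule poly_mapping_eqI) (use assms in \<open>auto simp: lookup_add lookup_minus lookup_single when_def\<close>)
qed

lemma split_edge:
  fixes a :: "'v \<Rightarrow>\<^sub>0 nat"
  assumes "x \<noteq> z" "lookup a x \<ge> 1" "lookup a z \<ge> 1"
  obtains b where "a = single x 1 + single z 1 + b"
proof -
  obtain c where c: "a = single x 1 + c" using assms(2) by (rule split_single)
  with assms have "lookup c z \<ge> 1" by (simp add: lookup_add lookup_single_not_eq)
  then obtain b where "c = single z 1 + b" by (rule split_single)
  with c show thesis by (intro that) (simp add: add.assoc)
qed

lemma edge_pow_mono: "E \<subseteq> E' \<Longrightarrow> edge_pow E t \<subseteq> edge_pow E' t"
  by (induction t) (simp, fastforce)

lemma edge_pow_SucI:
  "{x, z} \<in> E \<Longrightarrow> b \<in> edge_pow E t \<Longrightarrow>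
    single x 1 + single z 1 + b \<in> edge_pow E (Suc t)"
  by auto

lemma simple_graph_edge:
  assumes "simple_graph V E" "{x, z} \<in> E"
  shows "x \<noteq> z" "x \<in> V" "z \<in> V"
proof -
  have "card {x, z} = 2" "{x, z} \<subseteq> V" using assms unfolding simple_graph_def by auto
  then show "x \<noteq> z" "x \<in> V" "z \<in> V" by auto
qed

lemma simple_graph_edgeE:
  assumes "simple_graph V E" "e \<in> E"
  obtains x z where "e = {x, z}" "x \<noteq> z" "x \<in> V" "z \<in> V"
proof -
  have "card e = 2" "e \<subseteq> V" using assms unfolding simple_graph_def by auto
  then show thesis using that by (auto simp: card_2_iff)
qed

lemma simple_graph_subset: "simple_graph V E \<Longrightarrow> E' \<subseteq> E \<Longrightarrow> simple_graph V E'"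
  by (auto simp: simple_graph_def)

text \<open>Otherwise the vertices with exponent 0 would form a cover of weight 0.\<close>

lemma supported_edge_exists:
  assumes "simple_graph V E" "a \<in> heavy V E (Suc t)"
  obtains x z where "{x, z} \<in> E" "lookup a x \<ge> 1" "lookup a z \<ge> 1"
proof (rule ccontr)
  assume "\<not> thesis"
  with that have no: "\<not> (lookup a x \<ge> 1 \<and> lookup a z \<ge> 1)" if "{x, z} \<in> E" for x z
    using that by blast
  let ?S = "{v \<in> V. lookup a v = 0}"
  have "vertex_cover V E ?S"
    unfolding vertex_cover_def
  proof (intro conjI ballI)
    fix e assume "e \<in> E"
    with assms(1) obtain x z where "e = {x, z}" "x \<in> V" "z \<in> V" by (rule simple_graph_edgeE)
    with no[of x z] \<open>e \<in> E\<close> show "e \<inter> ?S \<noteq> {}" by (auto simp: not_less_eq_eq)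
  qed auto
  with assms(2) have "Suc t \<le> vertex_weight ?S a" by (auto simp: heavy_def)
  then show False by (simp add: vertex_weight_eq_0)
qed

text \<open>A cover containing both ends of \<open>{x, z}\<close> can drop \<open>x\<close> and take instead its neighbours other
  than \<open>z\<close>, which weigh nothing; hence such a cover is never tight.\<close>

lemma heavy_remove_leaf:
  assumes G: "simple_graph V E"
    and a: "single x 1 + single z 1 + b \<in> heavy V E (Suc t)"
      (is "?a \<in> _")
    and xz: "{x, z} \<in> E"
    and leaf: "\<And>w. {x, w} \<in> E \<Longrightarrow> w \<noteq> z \<Longrightarrow>
      lookup (single x 1 + single z 1 + b) w = 0"
  shows "b \<in> heavy V E t"
  unfolding heavy_def
proof (intro CollectI allI impI)
  fix S assume S: "vertex_cover V E S"
  have fin: "finite V" using G by (simp add: simple_graph_def)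
  with S have finS: "finite S" by (auto simp: vertex_cover_def finite_subset)
  note xz' = simple_graph_edge[OF G xz]
  have wS: "vertex_weight S ?a = (if x \<in> S then 1 else 0) + (if z \<in> S then 1 else 0) + vertex_weight S b"
    by (simp add: vertex_weight_add vertex_weight_single finS)
  show "t \<le> vertex_weight S b"
  proof (cases "x \<in> S \<and> z \<in> S")
    case False
    moreover have "Suc t \<le> vertex_weight S ?a" using a S by (auto simp: heavy_def)
    ultimately show ?thesis using wS by (auto split: if_splits)
  next
    case True
    let ?N = "{w \<in> V. {x, w} \<in> E \<and> w \<noteq> z} - S"
    let ?S = "(S - {x}) \<union> ?N"
    have "vertex_cover V E ?S"
      unfolding vertex_cover_def
    proof (intro conjI ballI)
      show "?S \<subseteq> V" using S by (auto simp: vertex_cover_def)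
    next
      fix e assume e: "e \<in> E"
      show "e \<inter> ?S \<noteq> {}"
      proof (cases "x \<in> e")
        case True
        from G e obtain p q where "e = {p, q}" "p \<noteq> q" "p \<in> V" "q \<in> V"
          by (rule simple_graph_edgeE)
        with True obtain w where w: "e = {x, w}" "w \<noteq> x" "w \<in> V" by fastforce
        then show ?thesis using \<open>x \<in> S \<and> z \<in> S\<close> e by (cases "w \<in> S") auto
      next
        case False
        then show ?thesis using S e by (auto simp: vertex_cover_def)
      qed
    qed
    then have "Suc t \<le> vertex_weight ?S ?a" using a by (auto simp: heavy_def)
    also have "\<dots> = vertex_weight (S - {x}) ?a + vertex_weight ?N ?a"
      by (rule vertex_weight_union) (use fin finS in auto)
    also have "vertex_weight ?N ?a = 0"
      by (rule vertex_weight_eq_0) (use leaf in auto)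
    also have "vertex_weight (S - {x}) ?a = 1 + vertex_weight (S - {x}) b"
      using True xz' finS by (simp add: vertex_weight_add vertex_weight_single)
    also have "vertex_weight (S - {x}) b \<le> vertex_weight S b"
      by (rule vertex_weight_mono) (use finS in auto)
    finally show ?thesis by simp
  qed
qed

section \<open>Packing along a path\<close>

definition path_edges :: "'v list \<Rightarrow> 'v set set" where
  "path_edges xs = {{xs ! i, xs ! Suc i} | i. Suc i < length xs}"

text \<open>The first edge along the path with both ends in the support starts at a leaf of the
  graph induced on the support, so it can be split off by \<open>heavy_remove_leaf\<close>.\<close>

lemma heavy_path:
  assumes "simple_graph V (path_edges xs)" "distinct xs" "a \<in> heavy V (path_edges xs) t"
  shows "a \<in> edge_pow (path_edges xs) t"
  using assms(3)
proof (induction t arbitrary: a)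
  case (Suc t)
  let ?P = "\<lambda>i. Suc i < length xs \<and> lookup a (xs ! i) \<ge> 1 \<and> lookup a (xs ! Suc i) \<ge> 1"
  obtain x z where "{x, z} \<in> path_edges xs" "lookup a x \<ge> 1" "lookup a z \<ge> 1"
    using supported_edge_exists[OF assms(1) Suc.prems] by blast
  then have "\<exists>i. ?P i" unfolding path_edges_def by (auto simp: doubleton_eq_iff)
  then obtain i where i: "?P i" and least: "\<And>j. j < i \<Longrightarrow> \<not> ?P j"
    using exists_least_iff[of ?P] by blast
  have ne: "xs ! i \<noteq> xs ! Suc i" using assms(2) i by (simp add: nth_eq_iff_index_eq)
  obtain b where b: "a = single (xs ! i) 1 + single (xs ! Suc i) 1 + b"
    using ne i by (auto elim: split_edge)
  have e: "{xs ! i, xs ! Suc i} \<in> path_edges xs" using i by (auto simp: path_edges_def)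
  have "b \<in> heavy V (path_edges xs) t"
  proof (rule heavy_remove_leaf[OF assms(1) _ e])
    \<comment> \<open>The other neighbour can only be the predecessor on the path. Its exponent is
      0, since otherwise an earlier edge would have been chosen.\<close>
    fix w assume w: "{xs ! i, w} \<in> path_edges xs" "w \<noteq> xs ! Suc i"
    then obtain j where j: "Suc j < length xs" "{xs ! i, w} = {xs ! j, xs ! Suc j}"
      by (auto simp: path_edges_def)
    then consider "xs ! i = xs ! j" "w = xs ! Suc j" | "xs ! i = xs ! Suc j" "w = xs ! j"
      by (auto simp: doubleton_eq_iff)
    then have "i = Suc j \<and> w = xs ! j"
      using w j i assms(2) by cases (auto simp: nth_eq_iff_index_eq)
    then show "lookup (single (xs ! i) 1 + single (xs ! Suc i) 1 + b) w = 0"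
      using least[of j] i j b by (auto simp: not_less_eq_eq)
  qed (use Suc.prems b in simp)
  then show ?case unfolding b by (intro edge_pow_SucI e Suc.IH)
qed simp

section \<open>Packing along an odd cycle\<close>

definition cycle_edges :: "'v list \<Rightarrow> 'v set set" where
  "cycle_edges xs = {{xs ! i, xs ! (Suc i mod length xs)} | i. i < length xs}"

lemma cycle_edges_eq_path_edges:
  assumes "xs \<noteq> []"
  shows "cycle_edges xs = insert {last xs, hd xs} (path_edges xs)"
proof -
  have *: "i < length xs \<longleftrightarrow> Suc i < length xs \<or> i = length xs - 1" for i
    using assms by (cases xs) auto
  have "cycle_edges xs = path_edges xs \<union> {{xs ! (length xs - 1), xs ! 0}}"
    unfolding cycle_edges_def path_edges_def
    apply (subst *) using assms by (auto; metis mod_less mod_self Suc_pred length_greater_0_conv)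
  then show ?thesis using assms by (simp add: last_conv_nth hd_conv_nth)
qed

text \<open>Rotating brings any chosen edge into the closing position, or any chosen vertex to the
  head. One inclusion suffices because a rotation is undone by a further rotation.\<close>

lemma cycle_edges_rotate: "cycle_edges (rotate k xs) = cycle_edges xs"
proof -
  have sub: "cycle_edges (rotate k xs) \<subseteq> cycle_edges xs" for k and xs :: "'a list"
  proof
    fix e assume "e \<in> cycle_edges (rotate k xs)"
    then obtain i where i: "i < length xs"
      and e: "e = {rotate k xs ! i, rotate k xs ! (Suc i mod length xs)}"
      by (auto simp: cycle_edges_def)
    have "e = {xs ! ((k + i) mod length xs), xs ! ((k + Suc i mod length xs) mod length xs)}"
      using i unfolding e by (subst (1 2) nth_rotate) (auto intro: mod_less_divisor)
    also have "(k + Suc i mod length xs) mod length xs = Suc ((k + i) mod length xs) mod length xs"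
      by (simp add: mod_simps)
    finally show "e \<in> cycle_edges xs" using i unfolding cycle_edges_def
      by (auto intro!: exI[of _ "(k + i) mod length xs"] mod_less_divisor)
  qed
  have "rotate (length xs - k mod length xs) (rotate k xs) = xs"
  proof (cases "xs = []")
    case False
    then have "(length xs - k mod length xs + k) mod length xs = 0"
      by (metis add.commute length_greater_0_conv mod_add_left_eq mod_le_divisor
          le_add_diff_inverse mod_self)
    then show ?thesis by (simp add: rotate_rotate rotate_id)
  qed simp
  with sub[of "length xs - k mod length xs" "rotate k xs"] sub[of k xs] show ?thesis by auto
qed

lemma ex_rotate_hd:
  assumes "x \<in> set xs"
  obtains k where "hd (rotate k xs) = x"
proof -
  from assms obtain k where k: "k < length xs" "xs ! k = x" by (auto simp: in_set_conv_nth)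
  then have "hd (rotate k xs) = xs ! (k mod length xs)" by (intro hd_rotate_conv_nth) auto
  with k that show thesis by simp
qed

text \<open>If no edge had both ends in \<open>S\<close>, membership in \<open>S\<close> would
  alternate around the cycle, which odd length forbids. The edge found is returned as the closing
  edge of a rotation.\<close>

lemma odd_cycle_cover_adjacent:
  assumes "odd (length xs)" "vertex_cover V (cycle_edges xs) S"
  obtains k where "last (rotate k xs) \<in> S" "hd (rotate k xs) \<in> S"
proof -
  let ?L = "length xs"
  have L: "?L > 0" using assms(1) by (cases xs) auto
  have "\<exists>i<?L. xs ! i \<in> S \<and> xs ! (Suc i mod ?L) \<in> S"
  proof (rule ccontr)
    assume "\<not> ?thesis"
    moreover have "xs ! i \<in> S \<or> xs ! (Suc i mod ?L) \<in> S" if "i < ?L" for i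
    proof -
      have "{xs ! i, xs ! (Suc i mod ?L)} \<in> cycle_edges xs"
        using that by (auto simp: cycle_edges_def)
      then have "{xs ! i, xs ! (Suc i mod ?L)} \<inter> S \<noteq> {}"
        using assms(2) unfolding vertex_cover_def by blast
      then show ?thesis by auto
    qed
    ultimately have alt: "xs ! (Suc i mod ?L) \<in> S \<longleftrightarrow> xs ! i \<notin> S" if "i < ?L" for i
      using that by blast
    have par: "i < ?L \<Longrightarrow> xs ! i \<in> S \<longleftrightarrow> (even i \<longleftrightarrow> xs ! 0 \<in> S)" for i
    proof (induction i)
      case (Suc i)
      with alt[of i] show ?case by auto
    qed simp
    have "xs ! 0 \<in> S \<longleftrightarrow> xs ! (?L - 1) \<notin> S" using alt[of "?L - 1"] L by simp
    moreover have "xs ! (?L - 1) \<in> S \<longleftrightarrow> xs ! 0 \<in> S" using par[of "?L - 1"] L assms(1) by simp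
    ultimately show False by blast
  qed
  then obtain i where i: "i < ?L" "xs ! i \<in> S" "xs ! (Suc i mod ?L) \<in> S" by blast
  \<comment> \<open>Rotating by \<open>Suc i\<close> moves position \<open>i\<close> to the end and
    its successor to the head.\<close>
  have "rotate (Suc i) xs \<noteq> []" using L by auto
  then have "last (rotate (Suc i) xs) = xs ! ((Suc i + (?L - 1)) mod ?L)"
    using L by (subst last_conv_nth) (auto simp del: rotate_Suc simp: nth_rotate)
  also have "Suc i + (?L - 1) = i + ?L" using L by simp
  finally have "last (rotate (Suc i) xs) \<in> S" using i by simp
  moreover have "hd (rotate (Suc i) xs) \<in> S"
    using i L by (subst hd_rotate_conv_nth) auto
  ultimately show thesis by (rule that)
qed

text \<open>Exchange argument: \<open>S\<close> contains both ends of the path and weighs at most \<open>t\<close>. If \<open>S\<close>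
  and \<open>T\<close> can be swapped behind some position, both results cover the closing edge too;
  otherwise \<open>T\<close> is the complement of \<open>S\<close>, which is heavy by the degree bound.\<close>

lemma heavy_path_if_light_cover:
  assumes fin: "finite V" and xs: "distinct xs" "xs \<noteq> []" "set xs \<subseteq> V"
    and a: "a \<in> heavy V (cycle_edges xs) t"
    and deg: "2 * t \<le> vertex_weight (set xs) a"
    and S: "vertex_cover V (cycle_edges xs) S" "vertex_weight S a \<le> t"
    and ends: "last xs \<in> S" "hd xs \<in> S"
  shows "a \<in> heavy V (path_edges xs) t"
  unfolding heavy_def
proof (intro CollectI allI impI)
  fix T assume T: "vertex_cover V (path_edges xs) T"
  let ?L = "length xs"
  have SV: "S \<subseteq> V" and TV: "T \<subseteq> V" using S T by (auto simp: vertex_cover_def)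
  then have finS: "finite S" and finT: "finite T" using fin finite_subset by auto
  have covS: "xs ! i \<in> S \<or> xs ! Suc i \<in> S" if "Suc i < ?L" for i
  proof -
    have "{xs ! i, xs ! Suc i} \<in> cycle_edges xs"
      using that by (auto simp: cycle_edges_eq_path_edges[OF xs(2)] path_edges_def)
    then have "{xs ! i, xs ! Suc i} \<inter> S \<noteq> {}" using S(1) unfolding vertex_cover_def by blast
    then show ?thesis by auto
  qed
  have covT: "xs ! i \<in> T \<or> xs ! Suc i \<in> T" if "Suc i < ?L" for i
  proof -
    have "{xs ! i, xs ! Suc i} \<in> path_edges xs" using that by (auto simp: path_edges_def)
    then have "{xs ! i, xs ! Suc i} \<inter> T \<noteq> {}" using T unfolding vertex_cover_def by blast
    then show ?thesis by auto
  qed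
  have weight_cover: "t \<le> vertex_weight R a"
    if "R \<subseteq> V" "last xs \<in> R \<or> hd xs \<in> R" "\<And>i. Suc i < ?L \<Longrightarrow> xs ! i \<in> R \<or> xs ! Suc i \<in> R" for R
  proof -
    have "vertex_cover V (cycle_edges xs) R"
      unfolding vertex_cover_def cycle_edges_eq_path_edges[OF xs(2)] path_edges_def
      using that by fastforce
    then show ?thesis using a by (auto simp: heavy_def)
  qed
  show "t \<le> vertex_weight T a"
  proof (cases "\<exists>p. Suc p < ?L \<and> (xs ! p \<in> S \<or> xs ! Suc p \<in> T) \<and> (xs ! p \<in> T \<or> xs ! Suc p \<in> S)")
    case True
    \<comment> \<open>The two disjunctions say that the edge at position \<open>p\<close> stays
      covered in both results when \<open>S\<close> and \<open>T\<close> are swapped behind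
      \<open>p\<close>.\<close>
    then obtain p where p: "Suc p < ?L" "xs ! p \<in> S \<or> xs ! Suc p \<in> T" "xs ! p \<in> T \<or> xs ! Suc p \<in> S"
      by blast
    let ?A = "(\<lambda>i. xs ! i) ` {..p}"
    have inA: "xs ! i \<in> ?A \<longleftrightarrow> i \<le> p" if "i < ?L" for i
      using that p(1) xs(1) by (auto simp: nth_eq_iff_index_eq)
    let ?S = "(S \<inter> ?A) \<union> (T - ?A)" and ?T = "(T \<inter> ?A) \<union> (S - ?A)"
    have hd: "hd xs = xs ! 0" and last: "last xs = xs ! (?L - 1)"
      using xs(2) by (auto simp: hd_conv_nth last_conv_nth)
    have "t \<le> vertex_weight ?S a"
    proof (rule weight_cover)
      \<comment> \<open>Here both ends of the path being in \<open>S\<close> is decisive: the head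
        stays in \<open>?S\<close>, and the last vertex stays in \<open>?T\<close>, so each result
        covers the closing edge.\<close>
      show "last xs \<in> ?S \<or> hd xs \<in> ?S" using ends inA[of 0] xs(2) by (auto simp: hd)
      show "xs ! i \<in> ?S \<or> xs ! Suc i \<in> ?S" if "Suc i < ?L" for i
        using covS[OF that] covT[OF that] p inA[of i] inA[of "Suc i"] that
        by (cases i p rule: linorder_cases) auto
    qed (use SV TV in auto)
    moreover have "t \<le> vertex_weight ?T a"
    proof (rule weight_cover)
      show "last xs \<in> ?T \<or> hd xs \<in> ?T" using ends inA[of "?L - 1"] p(1) by (auto simp: last)
      show "xs ! i \<in> ?T \<or> xs ! Suc i \<in> ?T" if "Suc i < ?L" for i
        using covS[OF that] covT[OF that] p inA[of i] inA[of "Suc i"] that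
        by (cases i p rule: linorder_cases) auto
    qed (use SV TV in auto)
    moreover have "vertex_weight ?S a + vertex_weight ?T a = vertex_weight S a + vertex_weight T a"
    proof -
      have "vertex_weight S a = vertex_weight (S \<inter> ?A) a + vertex_weight (S - ?A) a"
        using vertex_weight_union[of "S \<inter> ?A" "S - ?A" a] finS by (simp add: Int_Diff_Un Int_Diff_disjoint)
      moreover have "vertex_weight T a = vertex_weight (T \<inter> ?A) a + vertex_weight (T - ?A) a"
        using vertex_weight_union[of "T \<inter> ?A" "T - ?A" a] finT by (simp add: Int_Diff_Un Int_Diff_disjoint)
      moreover have "vertex_weight ?S a = vertex_weight (S \<inter> ?A) a + vertex_weight (T - ?A) a"
        by (rule vertex_weight_union) (use finS finT in auto)
      moreover have "vertex_weight ?T a = vertex_weight (T \<inter> ?A) a + vertex_weight (S - ?A) a"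
        by (rule vertex_weight_union) (use finS finT in auto)
      ultimately show ?thesis by simp
    qed
    \<comment> \<open>The swapped covers weigh at least \<open>t\<close> each and as much as
      \<open>S\<close> and \<open>T\<close> together, while \<open>S\<close> weighs at most
      \<open>t\<close>.\<close>
    ultimately show ?thesis using S(2) by linarith
  next
    case False
    show ?thesis
    \<comment> \<open>A single vertex gives no path edge, so the failed exchange carries no
      information; but then \<open>S\<close> contains the only vertex.\<close>
    proof (cases "?L = 1")
      case True
      then have "set xs \<subseteq> S" using ends by (cases xs) auto
      then have "vertex_weight (set xs) a \<le> vertex_weight S a"
        using finS by (intro vertex_weight_mono) auto
      then show ?thesis using deg S(2) by simp
    next
      case ne1: False
      \<comment> \<open>Where the exchange fails at an edge covered by \<open>S\<close> and by
        \<open>T\<close>, one end lies only in \<open>S\<close> and the other only in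
        \<open>T\<close>.\<close>
      have "set xs - S \<subseteq> T"
      proof
        fix v assume "v \<in> set xs - S"
        then obtain i where i: "i < ?L" "v = xs ! i" "xs ! i \<notin> S" by (auto simp: in_set_conv_nth)
        show "v \<in> T"
        proof (cases "Suc i < ?L")
          case True
          then show ?thesis using False covS[OF True] covT[OF True] i by blast
        next
          case l: False
          then obtain j where j: "i = Suc j" using ne1 i(1) by (cases i) auto
          have "Suc j < ?L" using i(1) j by simp
          then show ?thesis using False covS[of j] covT[of j] i j by blast
        qed
      qed
      then have "vertex_weight (set xs - S) a \<le> vertex_weight T a" by (rule vertex_weight_mono[OF finT])
      moreover have "vertex_weight (set xs) a \<le> vertex_weight (S \<union> (set xs - S)) a"
        by (rule vertex_weight_mono) (use finS in auto)
      moreover have "vertex_weight (S \<union> (set xs - S)) a = vertex_weight S a + vertex_weight (set xs - S) a"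
        by (rule vertex_weight_union) (use finS in auto)
      ultimately show ?thesis using S(2) deg by linarith
    qed
  qed
qed

text \<open>As long as every cover weighs more than the target, any edge of the support may be split
  off. Once a cover attains the target, rotating an edge with both ends in it to the closing
  position leaves a path, which packs all remaining edges at once.\<close>

lemma heavy_odd_cycle:
  assumes G: "simple_graph V (cycle_edges xs)" and xs: "distinct xs" "odd (length xs)" "set xs \<subseteq> V"
    and "a \<in> heavy V (cycle_edges xs) t" "2 * t \<le> vertex_weight (set xs) a"
  shows "a \<in> edge_pow (cycle_edges xs) t"
  using assms(5,6)
proof (induction t arbitrary: a)
  case (Suc t)
  let ?C = "cycle_edges xs"
  have fin: "finite V" using G by (simp add: simple_graph_def)
  show ?case
  proof (cases "\<exists>S. vertex_cover V ?C S \<and> vertex_weight S a \<le> Suc t")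
    case True
    then obtain S where S: "vertex_cover V ?C S" "vertex_weight S a \<le> Suc t" by blast
    from xs(2) S(1) obtain k where k: "last (rotate k xs) \<in> S" "hd (rotate k xs) \<in> S"
      by (rule odd_cycle_cover_adjacent)
    let ?ys = "rotate k xs"
    have ys: "distinct ?ys" "?ys \<noteq> []" "set ?ys \<subseteq> V" using xs by auto
    have sub: "path_edges ?ys \<subseteq> ?C"
      using cycle_edges_eq_path_edges[OF ys(2)] cycle_edges_rotate[of k xs] by auto
    have "a \<in> heavy V (path_edges ?ys) (Suc t)"
      by (rule heavy_path_if_light_cover[OF fin ys _ _ _ S(2) k])
        (use Suc.prems S(1) cycle_edges_rotate[of k xs] in auto)
    then have "a \<in> edge_pow (path_edges ?ys) (Suc t)"
      by (intro heavy_path[OF simple_graph_subset[OF G sub] ys(1)])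
    then show ?thesis using edge_pow_mono[OF sub] by blast
  next
    case False
    \<comment> \<open>Every cover has one unit to spare, so even a cover containing both ends of the
      removed edge stays heavy enough.\<close>
    then have big: "Suc (Suc t) \<le> vertex_weight S a" if "vertex_cover V ?C S" for S
      using that by (meson not_less_eq_eq)
    obtain x z where xz: "{x, z} \<in> ?C" "lookup a x \<ge> 1" "lookup a z \<ge> 1"
      using supported_edge_exists[OF G Suc.prems(1)] by blast
    have "x \<noteq> z" using simple_graph_edge[OF G xz(1)] by blast
    then obtain b where b: "a = single x 1 + single z 1 + b"
      using xz by (auto elim: split_edge)
    have w: "vertex_weight S a \<le> Suc (Suc (vertex_weight S b))" if "finite S" for S
      using that by (simp add: b vertex_weight_add vertex_weight_single)
    have "b \<in> heavy V ?C t"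
      unfolding heavy_def
    proof (intro CollectI allI impI)
      fix S assume S: "vertex_cover V ?C S"
      then have "finite S" using fin by (auto simp: vertex_cover_def finite_subset)
      with w[of S] big[OF S] show "t \<le> vertex_weight S b" by simp
    qed
    moreover have "2 * t \<le> vertex_weight (set xs) b" using w[of "set xs"] Suc.prems(2) by simp
    ultimately have "b \<in> edge_pow ?C t" by (rule Suc.IH)
    then show ?thesis unfolding b by (intro edge_pow_SucI xz)
  qed
qed simp

text \<open>A vertex of exponent 0 joins any cover at no cost and takes care of all edges at it, so
  these may be deleted.\<close>

lemma heavy_subgraph:
  assumes "a \<in> heavy V E t" "finite V" "x \<in> V" "lookup a x = 0" "\<And>e. e \<in> E - E' \<Longrightarrow> x \<in> e"
  shows "a \<in> heavy V E' t"
  unfolding heavy_def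
proof (intro CollectI allI impI)
  fix S assume S: "vertex_cover V E' S"
  then have fin: "finite S" using assms(2) by (auto simp: vertex_cover_def finite_subset)
  have "vertex_cover V E (insert x S)" using S assms(3,5) unfolding vertex_cover_def by blast
  then have "t \<le> vertex_weight (insert x S) a" using assms(1) by (auto simp: heavy_def)
  also have "\<dots> = vertex_weight S a"
    using fin assms(4) by (cases "x \<in> S") (auto simp: vertex_weight_def insert_absorb)
  finally show "t \<le> vertex_weight S a" .
qed

text \<open>If both ends of the pendant edge are in the support, that edge is split off at its leaf
  \<open>y\<close>. Otherwise an end of exponent 0 is used to delete edges: at \<open>y\<close> this
  leaves the odd cycle, at \<open>u\<close> a path.\<close>

lemma heavy_odd_cycle_with_pendant:
  assumes G: "simple_graph V E" and xs: "distinct xs" "odd (length xs)"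
    and V: "V = insert y (set xs)" "y \<notin> set xs" and u: "u \<in> set xs"
    and E: "E = insert {y, u} (cycle_edges xs)"
    and "a \<in> heavy V E t" "2 * t \<le> vertex_weight V a"
  shows "a \<in> edge_pow E t"
  using assms(8,9)
proof (induction t arbitrary: a)
  case (Suc t)
  let ?C = "cycle_edges xs"
  have fin: "finite V" using V by simp
  have C: "?C \<subseteq> E" using E by auto
  consider "lookup a y \<ge> 1" "lookup a u \<ge> 1" | "lookup a y = 0" | "lookup a u = 0"
    by linarith
  then show ?case
  proof cases
    case 1
    have yu: "{y, u} \<in> E" "y \<noteq> u" using E V u by auto
    then obtain b where b: "a = single y 1 + single u 1 + b" using 1 by (auto elim: split_edge)
    have "b \<in> heavy V E t"
    proof (rule heavy_remove_leaf[OF G _ yu(1)])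
      fix w assume "{y, w} \<in> E" "w \<noteq> u"
      then have "{y, w} \<in> ?C" using E by (auto simp: doubleton_eq_iff)
      then have "y \<in> set xs"
        unfolding cycle_edges_def by (auto simp: doubleton_eq_iff intro!: nth_mem mod_less_divisor)
      with V show "lookup (single y 1 + single u 1 + b) w = 0" by simp
    qed (use Suc.prems b in simp)
    moreover have "2 * t \<le> vertex_weight V b"
      using Suc.prems(2) fin by (simp add: b vertex_weight_add vertex_weight_single split: if_splits)
    ultimately have "b \<in> edge_pow E t" by (rule Suc.IH)
    then show ?thesis unfolding b by (intro edge_pow_SucI yu)
  next
    case 2
    have "a \<in> heavy V ?C (Suc t)"
      by (rule heavy_subgraph[OF Suc.prems(1) fin _ 2]) (use V E in auto)
    moreover have "vertex_weight V a = vertex_weight (set xs) a"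
      using 2 V by (simp add: vertex_weight_def)
    ultimately have "a \<in> edge_pow ?C (Suc t)"
      using Suc.prems(2) V by (intro heavy_odd_cycle[OF simple_graph_subset[OF G C] xs]) auto
    then show ?thesis using edge_pow_mono[OF C] by blast
  next
    case 3
    obtain k where k: "hd (rotate k xs) = u" using u by (rule ex_rotate_hd)
    let ?ys = "rotate k xs"
    have ys: "?ys \<noteq> []" using u by auto
    have C': "?C = insert {last ?ys, u} (path_edges ?ys)"
      using cycle_edges_eq_path_edges[OF ys] cycle_edges_rotate[of k xs] k by simp
    then have sub: "path_edges ?ys \<subseteq> E" using C by auto
    \<comment> \<open>With \<open>u\<close> rotated to the head, the two deleted edges, the pendant
      one and the closing one, both contain \<open>u\<close>.\<close>
    have "a \<in> heavy V (path_edges ?ys) (Suc t)"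
      by (rule heavy_subgraph[OF Suc.prems(1) fin _ 3]) (use V u E C' in auto)
    then have "a \<in> edge_pow (path_edges ?ys) (Suc t)"
      using xs(1) by (intro heavy_path[OF simple_graph_subset[OF G sub]]) auto
    then show ?thesis using edge_pow_mono[OF sub] by blast
  qed
qed simp

section \<open>Monomial ideals\<close>

lemma keys_add_nat: "keys (a + b) = keys a \<union> keys b"
  for a b :: "'v \<Rightarrow>\<^sub>0 nat"
  by (auto simp: in_keys_iff lookup_add)

lemma poly_mapping_eq_sum_single: "(\<Sum>k\<in>keys p. single k (lookup p k)) = p"
  by (rule poly_mapping_eqI)
    (auto simp: lookup_sum lookup_single when_def in_keys_iff)

section \<open>The polynomial ring as a commutative ring with explicit carrier\<close>

lemma poly_ring_simps [simp]:
  "p \<in> carrier (poly_ring V) \<longleftrightarrow> (\<forall>a\<in>keys p. keys a \<subseteq> V)"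
  "p \<otimes>\<^bsub>poly_ring V\<^esub> q = p * q"
  "\<one>\<^bsub>poly_ring V\<^esub> = 1"
  "\<zero>\<^bsub>poly_ring V\<^esub> = 0"
  "p \<oplus>\<^bsub>poly_ring V\<^esub> q = p + q"
  by (simp_all add: poly_ring_def)

lemma poly_ring_closed:
  fixes p q :: "('v \<Rightarrow>\<^sub>0 nat) \<Rightarrow>\<^sub>0 'k::comm_ring_1"
  assumes "p \<in> carrier (poly_ring V)" "q \<in> carrier (poly_ring V)"
  shows "p * q \<in> carrier (poly_ring V)" "p + q \<in> carrier (poly_ring V)" "- p \<in> carrier (poly_ring V)"
proof -
  show "p * q \<in> carrier (poly_ring V)"
    using assms keys_mult[of p q] by (fastforce simp: keys_add_nat)
  show "p + q \<in> carrier (poly_ring V)"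
    using assms keys_add[of p q] by fastforce
  show "- p \<in> carrier (poly_ring V)"
    using assms by (simp add: in_keys_iff)
qed

lemma cring_poly_ring: "cring (poly_ring V :: (('v \<Rightarrow>\<^sub>0 nat) \<Rightarrow>\<^sub>0 'k::comm_ring_1) ring)"
  (is "cring ?R")
proof (rule cringI)
  show "abelian_group ?R"
  proof (rule abelian_groupI)
    fix x assume x: "x \<in> carrier ?R"
    then show "\<exists>y\<in>carrier ?R. y \<oplus>\<^bsub>?R\<^esub> x = \<zero>\<^bsub>?R\<^esub>"
      by (intro bexI[of _ "- x"] poly_ring_closed(3)) auto
  next
    fix x y assume "x \<in> carrier ?R" "y \<in> carrier ?R"
    then show "x \<oplus>\<^bsub>?R\<^esub> y \<in> carrier ?R"
      using poly_ring_closed(2) unfolding poly_ring_simps(5) by blast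
  qed (simp_all add: ac_simps)
  show "comm_monoid ?R"
  proof (rule comm_monoidI)
    fix x y assume "x \<in> carrier ?R" "y \<in> carrier ?R"
    then show "x \<otimes>\<^bsub>?R\<^esub> y \<in> carrier ?R"
      using poly_ring_closed(1) unfolding poly_ring_simps(2) by blast
  qed (simp_all add: ac_simps)
qed (simp add: distrib_right)

lemma a_inv_poly_ring:
  assumes "p \<in> carrier (poly_ring V)"
  shows "\<ominus>\<^bsub>poly_ring V\<^esub> p = - p"
proof -
  interpret cring "poly_ring V :: (('a \<Rightarrow>\<^sub>0 nat) \<Rightarrow>\<^sub>0 'b) ring" by (rule cring_poly_ring)
  show ?thesis
    by (rule minus_equality) (use assms poly_ring_closed(3) in \<open>simp_all add: in_keys_iff\<close>)
qed

lemma a_minus_poly_ring: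
  assumes "q \<in> carrier (poly_ring V)"
  shows "p \<ominus>\<^bsub>poly_ring V\<^esub> q = p - q"
  using assms by (simp add: a_minus_def a_inv_poly_ring del: poly_ring_simps(1))

text \<open>The common form of all ideals in the proof, which turns their inclusions into inclusions
  of sets of exponents. \<open>M\<close> may contain exponents with support outside
  \<open>V\<close>, as \<open>edge_pow\<close> and \<open>heavy\<close> do; the carrier discards
  them.\<close>

definition mon_ideal :: "'v set \<Rightarrow> ('v \<Rightarrow>\<^sub>0 nat) set \<Rightarrow> (('v \<Rightarrow>\<^sub>0 nat) \<Rightarrow>\<^sub>0 'k::comm_ring_1) set" where
  "mon_ideal V M = {p \<in> carrier (poly_ring V). keys p \<subseteq> M}"

lemma keys_mon_ideal: "p \<in> mon_ideal V M \<Longrightarrow> a \<in> keys p \<Longrightarrow> a \<in> M"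
  by (auto simp: mon_ideal_def)

lemma mon_ideal_mono: "M \<subseteq> N \<Longrightarrow> mon_ideal V M \<subseteq> mon_ideal V N"
  by (auto simp: mon_ideal_def)

lemma ideal_mon_ideal:
  assumes "\<And>a b. a \<in> M \<Longrightarrow> a + b \<in> M"
  shows "ideal (mon_ideal V M :: (('v \<Rightarrow>\<^sub>0 nat) \<Rightarrow>\<^sub>0 'k::comm_ring_1) set) (poly_ring V)"
    (is "ideal ?I ?R")
proof -
  interpret cring ?R by (rule cring_poly_ring)
  have mult: "x * p \<in> ?I" if "p \<in> ?I" "x \<in> carrier ?R" for p x
  proof -
    have "keys (x * p) \<subseteq> M"
    proof
      fix d assume "d \<in> keys (x * p)"
      then obtain a b where "d = b + a" "a \<in> keys p" using keys_mult[of x p] by auto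
      with assms[of a b] keys_mon_ideal[OF that(1)] show "d \<in> M" by (simp add: add.commute)
    qed
    moreover have "p \<in> carrier ?R" using that(1) by (simp add: mon_ideal_def del: poly_ring_simps)
    then have "x * p \<in> carrier ?R" by (rule poly_ring_closed(1)[OF that(2)])
    ultimately show ?thesis by (simp add: mon_ideal_def del: poly_ring_simps)
  qed
  show ?thesis
  proof (rule idealI)
    show "ring ?R" by (rule ring_axioms)
    show "subgroup ?I (add_monoid ?R)"
    proof (rule add.subgroupI)
      show "?I \<subseteq> carrier ?R" unfolding mon_ideal_def by blast
      have "0 \<in> ?I" by (simp add: mon_ideal_def)
      then show "?I \<noteq> {}" by blast
      show "\<ominus>\<^bsub>?R\<^esub> p \<in> ?I" if "p \<in> ?I" for p
        using that by (subst a_inv_poly_ring) (simp_all add: mon_ideal_def in_keys_iff subset_iff)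
      show "p \<oplus>\<^bsub>?R\<^esub> q \<in> ?I" if "p \<in> ?I" "q \<in> ?I" for p q
      proof -
        have "p \<in> carrier ?R" "q \<in> carrier ?R" "keys p \<subseteq> M" "keys q \<subseteq> M"
          using that by (simp_all add: mon_ideal_def del: poly_ring_simps)
        then show ?thesis
          using poly_ring_closed(2)[of p V q] keys_add[of p q]
          by (simp add: mon_ideal_def del: poly_ring_simps(1)) blast
      qed
    qed
    show "x \<otimes>\<^bsub>?R\<^esub> p \<in> ?I" "p \<otimes>\<^bsub>?R\<^esub> x \<in> ?I" if "p \<in> ?I" "x \<in> carrier ?R" for p x
      using mult[OF that] by (simp_all add: mult.commute[of p x])
  qed
qed

text \<open>A polynomial is the sum of its terms, so only single terms need to be tested.\<close>

lemma mon_ideal_subset: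
  fixes J :: "(('v \<Rightarrow>\<^sub>0 nat) \<Rightarrow>\<^sub>0 'k::comm_ring_1) set"
  assumes J: "ideal J (poly_ring V)"
    and single: "\<And>a c. a \<in> M \<Longrightarrow> keys a \<subseteq> V \<Longrightarrow> single a c \<in> J"
  shows "mon_ideal V M \<subseteq> J"
proof
  fix p :: "('v \<Rightarrow>\<^sub>0 nat) \<Rightarrow>\<^sub>0 'k" assume p: "p \<in> mon_ideal V M"
  note J' = ideal.axioms(1)[OF J]
  have "(\<Sum>k\<in>K. single k (lookup p k)) \<in> J" if "K \<subseteq> keys p" for K
    using finite_subset[OF that finite_keys] that
  proof (induction K rule: finite_induct)
    case empty
    then show ?case using additive_subgroup.zero_closed[OF J'] by simp
  next
    case (insert k K)
    then have "single k (lookup p k) \<in> J" using p by (intro single) (auto simp: mon_ideal_def)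
    then show ?case using insert additive_subgroup.a_closed[OF J'] by simp
  qed
  from this[of "keys p"] show "p \<in> J" by (simp add: poly_mapping_eq_sum_single)
qed

lemma single_mem_mon_ideal: "a \<in> M \<Longrightarrow> keys a \<subseteq> V \<Longrightarrow> single a c \<in> mon_ideal V M"
  by (simp add: mon_ideal_def)

lemma ideal_multiples:
  "ideal (mon_ideal V {a + b | a b. a \<in> A} :: (('v \<Rightarrow>\<^sub>0 nat) \<Rightarrow>\<^sub>0 'k::comm_ring_1) set) (poly_ring V)"
  by (rule ideal_mon_ideal) (auto simp: add.assoc; blast)

text \<open>Translates the generated ideals of the statement, \<open>edge_ideal\<close> and the
  ideal of \<open>low_deg_monomials\<close>, into exponent sets.\<close>

lemma genideal_monomials:
  assumes A: "\<And>a. a \<in> A \<Longrightarrow> keys a \<subseteq> V"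
  shows "Idl\<^bsub>poly_ring V\<^esub> (monomial ` A) =
    (mon_ideal V {a + b | a b. a \<in> A} :: (('v \<Rightarrow>\<^sub>0 nat) \<Rightarrow>\<^sub>0 'k::comm_ring_1) set)"
    (is "?I = ?J")
proof
  interpret cring "poly_ring V :: (('v \<Rightarrow>\<^sub>0 nat) \<Rightarrow>\<^sub>0 'k) ring" by (rule cring_poly_ring)
  have carr: "monomial ` A \<subseteq> carrier (poly_ring V)" using A by (auto simp: monomial_def)
  show "?I \<subseteq> ?J"
  proof (rule genideal_minimal)
    show "ideal ?J (poly_ring V)" by (rule ideal_multiples)
    have "a \<in> {a + b | a b. a \<in> A}" if "a \<in> A" for a
      using that add_0_right[of a] by (metis (mono_tags, lifting) mem_Collect_eq)
    then show "monomial ` A \<subseteq> ?J" using A by (auto simp: monomial_def intro!: single_mem_mon_ideal)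
  qed
  have I: "ideal ?I (poly_ring V)" by (rule genideal_ideal[OF carr])
  show "?J \<subseteq> ?I"
  proof (rule mon_ideal_subset[OF I])
    fix d :: "'v \<Rightarrow>\<^sub>0 nat" and c :: 'k
    assume "d \<in> {a + b | a b. a \<in> A}" "keys d \<subseteq> V"
    then obtain a b where d: "d = a + b" "a \<in> A" "keys b \<subseteq> V" by (auto simp: keys_add_nat)
    have "monomial a \<in> ?I" using genideal_self[OF carr] d(2) by blast
    then have "monomial a \<otimes>\<^bsub>poly_ring V\<^esub> single b c \<in> ?I"
      using d(3) by (intro ideal.I_r_closed[OF I]) auto
    then show "single d c \<in> ?I" by (simp add: monomial_def mult_single d(1))
  qed
qed

section \<open>Powers of the edge ideal\<close>

lemma edge_ideal_eq:
  assumes "simple_graph V E"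
  shows "edge_ideal V E = mon_ideal V (edge_pow E 1)"
proof -
  let ?A = "{single x 1 + single z 1 | x z. {x, z} \<in> E} :: ('a \<Rightarrow>\<^sub>0 nat) set"
  have gens: "{var u * var v | u v. {u, v} \<in> E} = monomial ` ?A"
    by (auto simp: var_def monomial_def mult_single image_iff; metis)
  have edges: "edge_pow E 1 = {a + b | a b. a \<in> ?A}" by auto
  have "keys a \<subseteq> V" if "a \<in> ?A" for a
    using that simple_graph_edge[OF assms] by (auto simp: keys_add_nat)
  then show ?thesis unfolding edge_ideal_def gens edges by (rule genideal_monomials)
qed

lemma edge_pow_up: "a \<in> edge_pow E t \<Longrightarrow> a + b \<in> edge_pow E t"
proof (induction t arbitrary: a)
  case (Suc t)
  then obtain x z c where "a = single x 1 + single z 1 + c" "{x, z} \<in> E" "c \<in> edge_pow E t" by auto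
  with edge_pow_SucI[of x z E "c + b" t] Suc.IH[of c] show ?case
    by (simp add: add.assoc del: edge_pow.simps)
qed simp

lemma heavy_up: "a \<in> heavy V E t \<Longrightarrow> a + b \<in> heavy V E t"
  by (auto simp: heavy_def vertex_weight_add intro: trans_le_add1)

text \<open>One step in the recursion of \<open>edge_pow\<close> corresponds to one more factor
  \<open>edge_ideal V E\<close>. At power 0 both sides are the whole ring.\<close>

lemma edge_ideal_power:
  assumes G: "simple_graph V E"
  shows "(edge_ideal V E :: (('v \<Rightarrow>\<^sub>0 nat) \<Rightarrow>\<^sub>0 'k::comm_ring_1) set) [^]\<^bsub>ideals_set (poly_ring V)\<^esub> t =
    mon_ideal V (edge_pow E t)"
proof (induction t)
  case 0
  show ?case by (simp add: nat_pow_def ideals_set_def mon_ideal_def del: poly_ring_simps)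
next
  case (Suc t)
  let ?R = "poly_ring V :: (('v \<Rightarrow>\<^sub>0 nat) \<Rightarrow>\<^sub>0 'k) ring"
  let ?I = "mon_ideal V (edge_pow E t) :: (('v \<Rightarrow>\<^sub>0 nat) \<Rightarrow>\<^sub>0 'k) set"
  let ?J = "mon_ideal V (edge_pow E 1) :: (('v \<Rightarrow>\<^sub>0 nat) \<Rightarrow>\<^sub>0 'k) set"
  let ?K = "mon_ideal V (edge_pow E (Suc t)) :: (('v \<Rightarrow>\<^sub>0 nat) \<Rightarrow>\<^sub>0 'k) set"
  interpret cring ?R by (rule cring_poly_ring)
  have I: "ideal ?I ?R" and J: "ideal ?J ?R" and K: "ideal ?K ?R"
    by (rule ideal_mon_ideal, erule edge_pow_up)+
  have prod: "edge_ideal V E [^]\<^bsub>ideals_set ?R\<^esub> Suc t = ?I \<cdot>\<^bsub>?R\<^esub> ?J"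
    using Suc edge_ideal_eq[OF G, where 'b = 'k] by (simp add: nat_pow_def ideals_set_def)
  have "?I \<cdot>\<^bsub>?R\<^esub> ?J = ?K"
  proof
    have "p \<in> ?K" if "p \<in> ?I \<cdot>\<^bsub>?R\<^esub> ?J" for p
      using that
    proof induction
      case (prod i j)
      have "keys (i * j) \<subseteq> edge_pow E (Suc t)"
      proof
        fix d assume "d \<in> keys (i * j)"
        then obtain a b where d: "d = a + b" "a \<in> keys i" "b \<in> keys j" using keys_mult[of i j] by auto
        with prod have a: "a \<in> edge_pow E t" and "b \<in> edge_pow E 1" by (auto simp: mon_ideal_def)
        then obtain x z c where "b = single x 1 + single z 1 + c" "{x, z} \<in> E" by auto
        \<comment> \<open>The cofactor \<open>c\<close> of the new edge is absorbed into the
          exponent \<open>a\<close> of the other factor.\<close>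
        then show "d \<in> edge_pow E (Suc t)"
          using edge_pow_SucI[of x z E "a + c" t] edge_pow_up[OF a, of c]
          by (simp add: d(1) ac_simps)
      qed
      then show ?case using prod poly_ring_closed(1)[of i V j]
        by (auto simp: mon_ideal_def simp del: edge_pow.simps)
    next
      case (sum p q)
      then show ?case
        by (intro additive_subgroup.a_closed ideal.axioms(1)[OF K])
    qed
    then show "?I \<cdot>\<^bsub>?R\<^esub> ?J \<subseteq> ?K" by blast
    show "?K \<subseteq> ?I \<cdot>\<^bsub>?R\<^esub> ?J"
    proof (rule mon_ideal_subset[OF ideal_prod_is_ideal[OF I J]])
      fix a :: "'v \<Rightarrow>\<^sub>0 nat" and c :: 'k
      assume a: "a \<in> edge_pow E (Suc t)" "keys a \<subseteq> V"
      then obtain x z b where b: "a = b + (single x 1 + single z 1)" "{x, z} \<in> E" "b \<in> edge_pow E t"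
        by (auto simp: ac_simps)
      have "single b c \<otimes>\<^bsub>?R\<^esub> single (single x 1 + single z 1) 1 \<in> ?I \<cdot>\<^bsub>?R\<^esub> ?J"
      proof (intro ideal_prod.prod single_mem_mon_ideal)
        show "single x 1 + single z 1 \<in> edge_pow E 1"
          using edge_pow_SucI[OF b(2), of 0 0] by simp
      qed (use a b in \<open>auto simp: keys_add_nat\<close>)
      then show "single a c \<in> ?I \<cdot>\<^bsub>?R\<^esub> ?J" by (simp add: mult_single b(1))
    qed
  qed
  with prod show ?case by simp
qed

text \<open>Minimizing a weight and then each variable in turn isolates a single pair of exponents, whose terms
  cannot cancel in a product. This replaces a monomial order, since the type of variables is unordered.\<close>

definition isolates :: "'a::plus set \<Rightarrow> 'a set \<Rightarrow> 'a set \<Rightarrow> 'a set \<Rightarrow> bool" where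
  "isolates A B A' B' \<longleftrightarrow> A' \<subseteq> A \<and> B' \<subseteq> B \<and> A' \<noteq> {} \<and> B' \<noteq> {} \<and>
    (\<forall>a\<in>A. \<forall>b\<in>B. \<forall>a'\<in>A'. \<forall>b'\<in>B'. a + b = a' + b' \<longrightarrow> a \<in> A' \<and> b \<in> B')"

lemma isolatesD:
  assumes "isolates A B A' B'" "a \<in> A" "b \<in> B" "a' \<in> A'" "b' \<in> B'" "a + b = a' + b'"
  shows "a \<in> A'" "b \<in> B'"
proof -
  have "\<forall>a\<in>A. \<forall>b\<in>B. \<forall>a'\<in>A'. \<forall>b'\<in>B'. a + b = a' + b' \<longrightarrow> a \<in> A' \<and> b \<in> B'"
    using assms(1) unfolding isolates_def by (elim conjE)
  from this[rule_format, OF assms(2-6)] show "a \<in> A'" "b \<in> B'" by simp_all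
qed

lemma isolates_subset: "isolates A B A' B' \<Longrightarrow> A' \<subseteq> A" "isolates A B A' B' \<Longrightarrow> B' \<subseteq> B"
  by (simp_all add: isolates_def)

lemma isolates_trans:
  assumes "isolates A B A' B'" "isolates A' B' A'' B''"
  shows "isolates A B A'' B''"
  unfolding isolates_def
proof (intro conjI ballI impI)
  fix a b a' b' assume *: "a \<in> A" "b \<in> B" "a' \<in> A''" "b' \<in> B''" "a + b = a' + b'"
  have "a' \<in> A'" "b' \<in> B'" using * isolates_subset[OF assms(2)] by blast+
  then have "a \<in> A'" "b \<in> B'" using * by (blast dest: isolatesD[OF assms(1)])+
  then show "a \<in> A''" "b \<in> B''" using * by (blast dest: isolatesD[OF assms(2)])+
qed (use assms in \<open>auto simp: isolates_def\<close>)

definition minimizers :: "('a \<Rightarrow> nat) \<Rightarrow> 'a set \<Rightarrow> 'a set" where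
  "minimizers w A = {a \<in> A. \<forall>x\<in>A. w a \<le> w x}"

lemma minimizers_nonempty:
  assumes "A \<noteq> {}"
  shows "minimizers w A \<noteq> {}"
proof -
  obtain x where "x \<in> A" using assms by blast
  then obtain m where "m \<in> A" "\<forall>y. y \<in> A \<longrightarrow> w m \<le> w y"
    using ex_has_least_nat[of "\<lambda>x. x \<in> A" x w] by blast
  then show ?thesis by (auto simp: minimizers_def)
qed

text \<open>If a sum equals a sum of two minimizers, additivity leaves no room for either summand to
  exceed its minimum.\<close>

lemma isolates_minimizers:
  assumes w: "\<And>a b. w (a + b) = w a + w b" and "A \<noteq> {}" "B \<noteq> {}"
  shows "isolates A B (minimizers w A) (minimizers w B)"
  unfolding isolates_def
proof (intro conjI ballI impI)
  fix a b a' b' assume *: "a \<in> A" "b \<in> B" "a' \<in> minimizers w A" "b' \<in> minimizers w B" "a + b = a' + b'"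
  have "w a + w b = w a' + w b'" using *(5) w by metis
  moreover have "w a' \<le> w a" "w b' \<le> w b" using * by (auto simp: minimizers_def)
  ultimately have "w a = w a'" "w b = w b'" by linarith+
  then show "a \<in> minimizers w A" "b \<in> minimizers w B" using * by (auto simp: minimizers_def)
qed (use minimizers_nonempty[OF assms(2)] minimizers_nonempty[OF assms(3)] in \<open>auto simp: minimizers_def\<close>)

text \<open>With all of \<open>V\<close> for \<open>F\<close>, exponents supported in
  \<open>V\<close> are determined by these values, so one pair remains.\<close>

lemma isolates_constant:
  fixes A B :: "('v \<Rightarrow>\<^sub>0 nat) set"
  assumes "finite F" "A \<noteq> {}" "B \<noteq> {}"
  shows "\<exists>A' B'. isolates A B A' B' \<and>
    (\<forall>v\<in>F. \<forall>a\<in>A'. \<forall>a'\<in>A'. lookup a v = lookup a' v) \<and>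
    (\<forall>v\<in>F. \<forall>b\<in>B'. \<forall>b'\<in>B'. lookup b v = lookup b' v)"
  using assms(1)
proof (induction F rule: finite_induct)
  case empty
  have "isolates A B A B" using assms by (auto simp: isolates_def)
  then show ?case by blast
next
  case (insert v F)
  then obtain A1 B1 where 1: "isolates A B A1 B1"
    "\<forall>v\<in>F. \<forall>a\<in>A1. \<forall>a'\<in>A1. lookup a v = lookup a' v"
    "\<forall>v\<in>F. \<forall>b\<in>B1. \<forall>b'\<in>B1. lookup b v = lookup b' v"
    by (elim exE conjE)
  let ?A = "minimizers (\<lambda>a. lookup a v) A1" and ?B = "minimizers (\<lambda>a. lookup a v) B1"
  have "isolates A1 B1 ?A ?B"
    using 1(1) by (intro isolates_minimizers) (auto simp: lookup_add isolates_def)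
  show ?case
  proof (rule exI[of _ ?A], rule exI[of _ ?B], intro conjI)
    show "isolates A B ?A ?B" by (rule isolates_trans[OF 1(1)]) fact
    show "\<forall>x\<in>insert v F. \<forall>a\<in>?A. \<forall>a'\<in>?A. lookup a x = lookup a' x"
      using 1(2) by (auto simp: minimizers_def intro!: antisym)
    show "\<forall>x\<in>insert v F. \<forall>b\<in>?B. \<forall>b'\<in>?B. lookup b x = lookup b' x"
      using 1(3) by (auto simp: minimizers_def intro!: antisym)
  qed
qed

text \<open>Terms of least weight do not all cancel in a product. This makes the ideals of covers
  prime, and later their powers primary.\<close>

lemma min_weight_term_mult:
  fixes f g :: "('v \<Rightarrow>\<^sub>0 nat) \<Rightarrow>\<^sub>0 'k::idom"
  assumes fin: "finite V" and fg: "f \<in> carrier (poly_ring V)" "g \<in> carrier (poly_ring V)"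
    and w: "\<And>a b. w (a + b) = w a + (w b :: nat)"
    and ab: "a0 \<in> keys f" "b0 \<in> keys g"
  obtains a b where "a + b \<in> keys (f * g)" "w a \<le> w a0" "w b \<le> w b0"
proof -
  let ?A = "minimizers w (keys f)" and ?B = "minimizers w (keys g)"
  have 1: "isolates (keys f) (keys g) ?A ?B"
    using ab w by (intro isolates_minimizers) auto
  then obtain A B where 2: "isolates ?A ?B A B"
    and const: "\<forall>v\<in>V. \<forall>a\<in>A. \<forall>a'\<in>A. lookup a v = lookup a' v"
      "\<forall>v\<in>V. \<forall>b\<in>B. \<forall>b'\<in>B. lookup b v = lookup b' v"
    using isolates_constant[OF fin, of ?A ?B] by (auto simp: isolates_def)
  have iso: "isolates (keys f) (keys g) A B" by (rule isolates_trans[OF 1 2])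
  have eq: "a = a'" if "keys a \<subseteq> V" "keys a' \<subseteq> V" "\<forall>v\<in>V. lookup a v = lookup a' v"
    for a a' :: "'v \<Rightarrow>\<^sub>0 nat"
    by (rule poly_mapping_eqI) (metis in_keys_iff subsetD that)
  obtain a b where a: "a \<in> A" and b: "b \<in> B" using 2 by (auto simp: isolates_def)
  \<comment> \<open>Consequently only one pair contributes to the coefficient at
    \<open>a + b\<close>, which is a product of two nonzero elements of a domain.\<close>
  have unique: "a' = a \<and> b' = b" if "a' \<in> keys f" "b' \<in> keys g" "a' + b' = a + b" for a' b'
  proof -
    have A: "a' \<in> A" "b' \<in> B" by (rule isolatesD[OF iso that(1,2) a b that(3)])+
    have carr: "keys x \<subseteq> V" if "x \<in> A \<or> x \<in> B" for x
      using that isolates_subset[OF iso] fg unfolding poly_ring_simps by blast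
    show ?thesis
    proof
      show "a' = a" by (rule eq[OF carr carr]) (use A(1) a const(1) in blast)+
      show "b' = b" by (rule eq[OF carr carr]) (use A(2) b const(2) in blast)+
    qed
  qed
  have keys: "a \<in> keys f" "b \<in> keys g" using a b isolates_subset[OF iso] by auto
  have "f * g = (\<Sum>p\<in>keys f. single p (lookup f p)) * (\<Sum>q\<in>keys g. single q (lookup g q))"
    by (simp add: poly_mapping_eq_sum_single)
  also have "\<dots> = (\<Sum>p\<in>keys f. \<Sum>q\<in>keys g. single (p + q) (lookup f p * lookup g q))"
    by (simp add: sum_product mult_single)
  finally have "lookup (f * g) (a + b) =
      (\<Sum>p\<in>keys f. \<Sum>q\<in>keys g. if p + q = a + b then lookup f p * lookup g q else 0)"
    by (simp add: lookup_sum lookup_single when_def)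
  also have "\<dots> = (\<Sum>p\<in>keys f. \<Sum>q\<in>keys g. if p = a \<and> q = b then lookup f p * lookup g q else 0)"
    by (intro sum.cong if_cong refl) (use unique in blast)
  also have "\<dots> = (\<Sum>p\<in>keys f. if p = a then lookup f p * lookup g b else 0)"
    using keys(2) by (intro sum.cong refl) (auto simp: sum.delta)
  also have "\<dots> = lookup f a * lookup g b" using keys(1) by simp
  finally have "lookup (f * g) (a + b) \<noteq> 0" using keys by (simp add: in_keys_iff)
  moreover have "w a \<le> w a0" "w b \<le> w b0"
    using 2 a b ab by (auto simp: isolates_def minimizers_def)
  ultimately show thesis using that by (simp add: in_keys_iff)
qed

section \<open>Symbolic powers of edge ideals\<close>

text \<open>Some edge is covered by \<open>v\<close> alone, since otherwise \<open>v\<close> could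
  be dropped from the cover.\<close>

lemma minimal_cover_neighbour:
  assumes G: "simple_graph V E" and W: "minimal_vertex_cover V E W" and v: "v \<in> W"
  obtains z where "{v, z} \<in> E" "z \<in> V - W"
proof -
  have cov: "vertex_cover V E W" using W by (simp add: minimal_vertex_cover_def)
  have "W - {v} \<subset> W" using v by auto
  then have "\<not> vertex_cover V E (W - {v})" using W by (simp add: minimal_vertex_cover_def)
  then obtain e where e: "e \<in> E" "e \<inter> (W - {v}) = {}" using cov by (auto simp: vertex_cover_def)
  moreover have "e \<inter> W \<noteq> {}" using cov e by (auto simp: vertex_cover_def)
  moreover obtain p q where pq: "e = {p, q}" "p \<noteq> q" "p \<in> V" "q \<in> V"
    using G e(1) by (rule simple_graph_edgeE)
  ultimately have "v = p \<and> q \<notin> W \<or> v = q \<and> p \<notin> W" by auto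
  moreover have "{q, p} \<in> E" using e(1) pq(1) by (simp add: insert_commute)
  ultimately show thesis using that[of p] that[of q] e(1) pq by auto
qed

lemma minimal_cover_exists:
  assumes "finite V" "vertex_cover V E S"
  obtains W where "minimal_vertex_cover V E W" "W \<subseteq> S"
proof -
  have "finite S" using assms by (auto simp: vertex_cover_def finite_subset)
  then have "\<exists>W. W \<subseteq> S \<and> minimal_vertex_cover V E W"
    using assms(2)
  proof (induction S rule: finite_psubset_induct)
    case (psubset S)
    show ?case
    proof (cases "minimal_vertex_cover V E S")
      case False
      then obtain S' where "S' \<subset> S" "vertex_cover V E S'"
        using psubset.prems by (auto simp: minimal_vertex_cover_def)
      with psubset.IH[of S'] show ?thesis by blast
    qed auto
  qed
  with that show thesis by blast
qed

text \<open>Every cover contains a minimal one, and weights grow with the set.\<close>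

lemma heavy_iff_minimal:
  assumes "finite V"
  shows "a \<in> heavy V E t \<longleftrightarrow> (\<forall>W. minimal_vertex_cover V E W \<longrightarrow> t \<le> vertex_weight W a)"
proof
  assume "a \<in> heavy V E t"
  then show "\<forall>W. minimal_vertex_cover V E W \<longrightarrow> t \<le> vertex_weight W a"
    by (auto simp: heavy_def minimal_vertex_cover_def)
next
  assume min: "\<forall>W. minimal_vertex_cover V E W \<longrightarrow> t \<le> vertex_weight W a"
  show "a \<in> heavy V E t"
    unfolding heavy_def
  proof (intro CollectI allI impI)
    fix S assume S: "vertex_cover V E S"
    with assms obtain W where W: "minimal_vertex_cover V E W" "W \<subseteq> S" by (rule minimal_cover_exists)
    have "finite S" using assms S by (auto simp: vertex_cover_def finite_subset)
    then have "vertex_weight W a \<le> vertex_weight S a" using W(2) by (rule vertex_weight_mono)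
    with min W(1) show "t \<le> vertex_weight S a" by fastforce
  qed
qed

text \<open>Each of the \<open>t\<close> edges has an end in the cover and contributes at least
  1.\<close>

lemma edge_pow_weight:
  assumes "finite V" "vertex_cover V E W" "a \<in> edge_pow E t"
  shows "t \<le> vertex_weight W a"
  using assms(3)
proof (induction t arbitrary: a)
  case (Suc t)
  then obtain x z b where a: "a = single x 1 + single z 1 + b" "{x, z} \<in> E" "b \<in> edge_pow E t" by auto
  have "finite W" using assms(1,2) by (auto simp: vertex_cover_def finite_subset)
  moreover have "{x, z} \<inter> W \<noteq> {}" using assms(2) a(2) unfolding vertex_cover_def by blast
  ultimately show ?case using Suc.IH[OF a(3)]
    by (auto simp: a(1) vertex_weight_add vertex_weight_single)
qed simp

text \<open>A converse of \<open>edge_pow_weight\<close> once the variables outside \<open>W\<close>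
  are available in high power: each vertex of \<open>W\<close> in the monomial is paired with a
  neighbour outside \<open>W\<close>. It expresses that the edge ideal and the prime of
  \<open>W\<close> agree after inverting these variables.\<close>

lemma edge_pow_if_weight:
  assumes G: "simple_graph V E" and W: "minimal_vertex_cover V E W"
    and "t \<le> vertex_weight W a" "\<And>z. z \<in> V - W \<Longrightarrow> t \<le> lookup a z"
  shows "a \<in> edge_pow E t"
  using assms(3,4)
proof (induction t arbitrary: a)
  case (Suc t)
  have "finite W" using G W
    by (auto simp: minimal_vertex_cover_def vertex_cover_def simple_graph_def finite_subset)
  have "\<exists>v\<in>W. lookup a v \<ge> 1"
    using Suc.prems(1) vertex_weight_eq_0[of W a] by fastforce
  then obtain v where v: "v \<in> W" "lookup a v \<ge> 1" by blast
  obtain z where z: "{v, z} \<in> E" "z \<in> V - W" using minimal_cover_neighbour[OF G W v(1)] by blast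
  have "v \<noteq> z" using v z by auto
  moreover have "lookup a z \<ge> 1" using Suc.prems(2)[OF z(2)] by simp
  ultimately obtain b where b: "a = single v 1 + single z 1 + b" using v(2) by (auto elim: split_edge)
  have "b \<in> edge_pow E t"
  proof (rule Suc.IH)
    \<comment> \<open>\<open>z\<close> lies outside \<open>W\<close>, so the removed edge uses
      exactly one unit of the weight.\<close>
    show "t \<le> vertex_weight W b"
      using Suc.prems(1) \<open>finite W\<close> v z by (simp add: b vertex_weight_add vertex_weight_single)
    show "t \<le> lookup b y" if "y \<in> V - W" for y
    proof -
      have "v \<noteq> y" using that v by auto
      then show ?thesis using Suc.prems(2)[OF that]
        by (simp add: b lookup_add lookup_single when_def split: if_splits)
    qed
  qed
  then show ?case unfolding b by (intro edge_pow_SucI z)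
qed simp

text \<open>The product of the variables in \<open>U\<close>, raised to the power \<open>N\<close>.
  For \<open>U\<close> the complement of a minimal cover it lies outside the prime of that cover and
  supplies the partners that \<open>edge_pow_if_weight\<close> asks for.\<close>

definition constant_exponent :: "'v set \<Rightarrow> nat \<Rightarrow> ('v \<Rightarrow>\<^sub>0 nat)" where
  "constant_exponent U N = (\<Sum>v\<in>U. single v N)"

lemma lookup_constant_exponent: "finite U \<Longrightarrow> lookup (constant_exponent U N) v = (if v \<in> U then N else 0)"
  by (simp add: constant_exponent_def lookup_sum lookup_single when_def)

lemma keys_constant_exponent: "finite U \<Longrightarrow> keys (constant_exponent U N) \<subseteq> U"
  by (auto simp: in_keys_iff lookup_constant_exponent split: if_splits)

text \<open>For a finite set \<open>W\<close> of vertices in \<open>V\<close> this is the ideal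
  generated by the variables of \<open>W\<close>. If two polynomials each have a term of weight 0,
  so does their product.\<close>

lemma primeideal_cover:
  assumes "finite V"
  shows "primeideal (mon_ideal V {a. 1 \<le> vertex_weight W a} :: (('v \<Rightarrow>\<^sub>0 nat) \<Rightarrow>\<^sub>0 'k::idom) set)
    (poly_ring V)" (is "primeideal ?P ?R")
proof (rule primeidealI)
  show "ideal ?P ?R" by (rule ideal_mon_ideal) (simp add: vertex_weight_add)
  have "1 \<in> carrier ?R" "1 \<notin> ?P" by (auto simp: mon_ideal_def vertex_weight_def)
  then show "carrier ?R \<noteq> ?P" by metis
  fix f g assume fg: "f \<in> carrier ?R" "g \<in> carrier ?R" "f \<otimes>\<^bsub>?R\<^esub> g \<in> ?P"
  show "f \<in> ?P \<or> g \<in> ?P"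
  proof (rule ccontr)
    assume "\<not> ?thesis"
    then have "\<not> keys f \<subseteq> {a. 1 \<le> vertex_weight W a}" "\<not> keys g \<subseteq> {a. 1 \<le> vertex_weight W a}"
      using fg(1,2) unfolding mon_ideal_def by blast+
    then obtain a0 b0 where *: "a0 \<in> keys f" "b0 \<in> keys g" "vertex_weight W a0 = 0" "vertex_weight W b0 = 0"
      unfolding subset_iff mem_Collect_eq not_all not_imp by (meson less_one not_le)
    obtain a b where "a + b \<in> keys (f * g)" "vertex_weight W a \<le> 0" "vertex_weight W b \<le> 0"
      using min_weight_term_mult[OF assms fg(1,2) vertex_weight_add[of W] *(1,2)] *(3,4) by auto
    then show False using fg(3) by (force simp: mon_ideal_def vertex_weight_add)
  qed
qed (rule cring_poly_ring)

text \<open>The witness is the product \<open>f\<close> of all variables outside \<open>W\<close>. A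
  term containing a vertex of \<open>W\<close>, times \<open>f\<close>, is divisible by an edge from
  that vertex to the complement of \<open>W\<close>. Conversely, \<open>f\<close> is outside the
  prime, which contains the edge ideal.\<close>

lemma associated_prime_cover:
  assumes G: "simple_graph V E" and W: "minimal_vertex_cover V E W"
  shows "(mon_ideal V {a. 1 \<le> vertex_weight W a} :: (('v \<Rightarrow>\<^sub>0 nat) \<Rightarrow>\<^sub>0 'k::idom) set)
    \<in> associated_primes (poly_ring V) (edge_ideal V E)" (is "?P \<in> associated_primes ?R ?I")
proof -
  have fin: "finite V" using G by (simp add: simple_graph_def)
  have I: "?I = mon_ideal V (edge_pow E 1)" by (rule edge_ideal_eq[OF G])
  have cov: "vertex_cover V E W" using W by (simp add: minimal_vertex_cover_def)
  interpret P: primeideal ?P ?R by (rule primeideal_cover[OF fin])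
  define m where "m = constant_exponent (V - W) 1"
  define f :: "('v \<Rightarrow>\<^sub>0 nat) \<Rightarrow>\<^sub>0 'k" where "f = monomial m"
  have keys_m: "keys m \<subseteq> V - W" unfolding m_def using fin by (intro keys_constant_exponent) auto
  then have f: "f \<in> carrier ?R" by (auto simp: f_def monomial_def)
  have "vertex_weight W m = 0"
    using keys_m by (intro vertex_weight_eq_0) (auto simp: in_keys_iff)
  then have fP: "f \<notin> ?P" by (simp add: f_def monomial_def mon_ideal_def)
  have "g \<in> ?P \<longleftrightarrow> g * f \<in> ?I" if g: "g \<in> carrier ?R" for g
  proof
    assume "g * f \<in> ?I"
    moreover have "?I \<subseteq> ?P"
      using edge_pow_weight[OF fin cov, of _ 1] unfolding I mon_ideal_def by blast
    ultimately show "g \<in> ?P" using P.I_prime[OF g f] fP by auto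
  next
    assume gP: "g \<in> ?P"
    have "keys (g * f) \<subseteq> edge_pow E 1"
    proof
      fix d assume "d \<in> keys (g * f)"
      then obtain a where d: "d = a + m" "a \<in> keys g"
        using keys_mult[of g f] by (auto simp: f_def monomial_def)
      show "d \<in> edge_pow E 1"
      proof (rule edge_pow_if_weight[OF G W])
        show "1 \<le> vertex_weight W d" using gP d by (force simp: mon_ideal_def vertex_weight_add)
        show "1 \<le> lookup d z" if "z \<in> V - W" for z
          using that fin by (simp add: d(1) m_def lookup_add lookup_constant_exponent)
      qed
    qed
    then show "g * f \<in> ?I" using poly_ring_closed(1)[OF g f] unfolding I mon_ideal_def by blast
  qed
  then have "?P = {g \<in> carrier ?R. g \<otimes>\<^bsub>?R\<^esub> f \<in> ?I}"
    using P.a_subset by (auto simp del: poly_ring_simps(1))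
  then show ?thesis unfolding associated_primes_def using P.primeideal f by blast
qed

text \<open>Let \<open>P = (I : f)\<close> and take a monomial of \<open>f\<close> outside \<open>I\<close>. Its support is independent, so some
  minimal cover \<open>W\<close> avoids it; then \<open>f\<close> is not in the prime of \<open>W\<close>, which therefore contains \<open>P\<close>.\<close>

lemma minimal_cover_of_associated_prime:
  fixes P :: "(('v \<Rightarrow>\<^sub>0 nat) \<Rightarrow>\<^sub>0 'k::idom) set"
  assumes G: "simple_graph V E" and P: "P \<in> associated_primes (poly_ring V) (edge_ideal V E)"
  shows "minimal_vertex_cover V E {v \<in> V. var v \<in> P}" (is "minimal_vertex_cover V E ?W")
proof -
  let ?R = "poly_ring V :: (('v \<Rightarrow>\<^sub>0 nat) \<Rightarrow>\<^sub>0 'k) ring"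
  let ?I = "edge_ideal V E :: (('v \<Rightarrow>\<^sub>0 nat) \<Rightarrow>\<^sub>0 'k) set"
  have fin: "finite V" using G by (simp add: simple_graph_def)
  have I: "?I = mon_ideal V (edge_pow E 1)" by (rule edge_ideal_eq[OF G])
  interpret cring ?R by (rule cring_poly_ring)
  interpret I: ideal ?I ?R unfolding I by (rule ideal_mon_ideal, erule edge_pow_up)
  obtain f where f: "f \<in> carrier ?R" "P = {g \<in> carrier ?R. g \<otimes>\<^bsub>?R\<^esub> f \<in> ?I}" and "primeideal P ?R"
    using P by (auto simp: associated_primes_def)
  interpret P: primeideal P ?R by fact
  have var_carr: "var v \<in> carrier ?R" if "v \<in> V" for v
    using that by (simp add: var_def monomial_def)
  \<comment> \<open>The product of the ends of an edge lies in the edge ideal, hence in the prime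
    \<open>P\<close>, so one of the two variables does.\<close>
  have cov: "vertex_cover V E ?W"
    unfolding vertex_cover_def
  proof (intro conjI ballI)
    fix e assume "e \<in> E"
    with G obtain x z where e: "e = {x, z}" "x \<in> V" "z \<in> V" by (rule simple_graph_edgeE)
    have "var x * var z \<in> ?I"
      using edge_pow_SucI[of x z E 0 0] e \<open>e \<in> E\<close>
      by (auto simp: I var_def monomial_def mult_single mon_ideal_def keys_add_nat)
    then have "var x \<otimes>\<^bsub>?R\<^esub> var z \<in> ?I" by simp
    from I.I_r_closed[OF this f(1)] have "var x \<otimes>\<^bsub>?R\<^esub> var z \<otimes>\<^bsub>?R\<^esub> f \<in> ?I" .
    moreover have "var x \<otimes>\<^bsub>?R\<^esub> var z \<in> carrier ?R"
      by (intro m_closed var_carr e)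
    ultimately have "var x \<otimes>\<^bsub>?R\<^esub> var z \<in> P"
      by (simp only: f(2) mem_Collect_eq)
    then have "var x \<in> P \<or> var z \<in> P" by (rule P.I_prime[OF var_carr[OF e(2)] var_carr[OF e(3)]])
    then show "e \<inter> ?W \<noteq> {}" using e by auto
  qed auto
  have "f \<notin> ?I"
  proof
    assume "f \<in> ?I"
    have "g \<in> P" if "g \<in> carrier ?R" for g
      using that I.I_l_closed[OF \<open>f \<in> ?I\<close> that] by (simp only: f(2) mem_Collect_eq)
    then have "carrier ?R = P" using P.a_subset by blast
    with P.I_notcarr show False ..
  qed
  then have "\<not> keys f \<subseteq> edge_pow E 1"
    using f(1) by (simp only: I mon_ideal_def mem_Collect_eq simp_thms)
  then obtain b where b: "b \<in> keys f" "b \<notin> edge_pow E 1" by blast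
  have "vertex_cover V E (V - keys b)"
    unfolding vertex_cover_def
  proof (intro conjI ballI)
    fix e assume "e \<in> E"
    with G obtain x z where e: "e = {x, z}" "x \<noteq> z" "x \<in> V" "z \<in> V" by (rule simple_graph_edgeE)
    have "\<not> (lookup b x \<ge> 1 \<and> lookup b z \<ge> 1)"
    proof
      assume "lookup b x \<ge> 1 \<and> lookup b z \<ge> 1"
      then obtain c where "b = single x 1 + single z 1 + c" using e(2) by (auto elim: split_edge)
      then have "b \<in> edge_pow E 1" using edge_pow_SucI[of x z E c 0] e(1) \<open>e \<in> E\<close> by simp
      with b(2) show False ..
    qed
    then show "e \<inter> (V - keys b) \<noteq> {}" using e by (auto simp: in_keys_iff)
  qed auto
  with fin obtain W where W: "minimal_vertex_cover V E W" "W \<subseteq> V - keys b"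
    by (rule minimal_cover_exists)
  have covW: "vertex_cover V E W" using W by (simp add: minimal_vertex_cover_def)
  let ?Q = "mon_ideal V {a. 1 \<le> vertex_weight W a} :: (('v \<Rightarrow>\<^sub>0 nat) \<Rightarrow>\<^sub>0 'k) set"
  interpret Q: primeideal ?Q ?R by (rule primeideal_cover[OF fin])
  have "vertex_weight W b = 0" using W(2) by (intro vertex_weight_eq_0) (auto simp: in_keys_iff)
  then have fQ: "f \<notin> ?Q" using keys_mon_ideal[OF _ b(1)] by fastforce
  have "edge_pow E 1 \<subseteq> {a. 1 \<le> vertex_weight W a}"
    using edge_pow_weight[OF fin covW] by blast
  then have IQ: "?I \<subseteq> ?Q" unfolding I by (rule mon_ideal_mono)
  have "?W \<subseteq> W"
  proof
    fix v assume v: "v \<in> ?W"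
    then have "var v \<in> P" by simp
    then have "var v \<otimes>\<^bsub>?R\<^esub> f \<in> ?I" by (simp only: f(2) mem_Collect_eq)
    then have "var v \<otimes>\<^bsub>?R\<^esub> f \<in> ?Q" using IQ by (rule rev_subsetD)
    moreover have "var v \<in> carrier ?R" using v by (intro var_carr) simp
    ultimately have "var v \<in> ?Q" using Q.I_prime[OF _ f(1)] fQ by blast
    then have "1 \<le> vertex_weight W (single v 1)" by (simp add: mon_ideal_def var_def monomial_def)
    moreover have "finite W" using covW fin by (auto simp: vertex_cover_def finite_subset)
    ultimately show "v \<in> W" by (simp add: vertex_weight_single split: if_splits)
  qed
  \<comment> \<open>A cover contained in a minimal cover equals it.\<close>
  then have "?W = W" using W(1) cov by (auto simp: minimal_vertex_cover_def)
  with W(1) show ?thesis by simp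
qed

text \<open>A product of elements outside a prime stays outside; one induction runs over the
  variables, one over the powers of a variable.\<close>

lemma constant_exponent_notin_prime:
  fixes P :: "(('v \<Rightarrow>\<^sub>0 nat) \<Rightarrow>\<^sub>0 'k::idom) set"
  assumes P: "primeideal P (poly_ring V)" and "finite U" "U \<subseteq> V" "\<And>v. v \<in> U \<Longrightarrow> var v \<notin> P"
  shows "monomial (constant_exponent U N) \<notin> P"
  using assms(2-4)
proof (induction U rule: finite_induct)
  case empty
  interpret primeideal P "poly_ring V" by (rule P)
  have "\<one>\<^bsub>poly_ring V\<^esub> \<notin> P" using one_imp_carrier I_notcarr by blast
  then show ?case by (simp add: constant_exponent_def monomial_def)
next
  case (insert v U)
  interpret primeideal P "poly_ring V" by (rule P)
  have carr: "monomial (single v k) \<in> carrier (poly_ring V)" for k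
    using insert by (simp add: monomial_def)
  have power: "monomial (single v k) \<notin> P" for k
  proof (induction k)
    case 0
    have "\<one>\<^bsub>poly_ring V\<^esub> \<notin> P" using one_imp_carrier I_notcarr by blast
    then show ?case by (simp add: monomial_def)
  next
    case (Suc k)
    have eq: "monomial (single v (Suc k)) = var v \<otimes>\<^bsub>poly_ring V\<^esub> monomial (single v k)"
      by (simp add: var_def monomial_def mult_single flip: single_add)
    have "var v \<in> carrier (poly_ring V)" using insert.prems(1) by (simp add: var_def monomial_def)
    moreover have "var v \<notin> P" using insert.prems(2) by simp
    ultimately show ?case using I_prime[OF _ carr[of k]] Suc unfolding eq by metis
  qed
  have eq: "monomial (constant_exponent (insert v U) N) =
      monomial (single v N) \<otimes>\<^bsub>poly_ring V\<^esub> monomial (constant_exponent U N)"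
    using insert.hyps by (simp add: constant_exponent_def monomial_def mult_single)
  have "monomial (constant_exponent U N) \<in> carrier (poly_ring V)"
    using keys_constant_exponent[of U N] insert by (auto simp: monomial_def)
  moreover have "monomial (constant_exponent U N) \<notin> P" using insert.prems by (intro insert.IH) auto
  ultimately show ?case using I_prime[OF carr[of N]] power[of N] unfolding eq by metis
qed

section \<open>Fractions and symbolic powers\<close>

lemma mem_loc_frac_poly_ring:
  assumes "s \<in> carrier (poly_ring V)"
  shows "(b, u) \<in> loc_frac (poly_ring V) P a s \<longleftrightarrow> b \<in> carrier (poly_ring V) \<and>
    u \<in> carrier (poly_ring V) - P \<and> (\<exists>q\<in>carrier (poly_ring V) - P. q * (a * u - b * s) = 0)"
proof (cases "b \<in> carrier (poly_ring V)")
  case True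
  then have "b * s \<in> carrier (poly_ring V)" using assms by (intro poly_ring_closed(1))
  then have "(a \<otimes>\<^bsub>poly_ring V\<^esub> u) \<ominus>\<^bsub>poly_ring V\<^esub> (b \<otimes>\<^bsub>poly_ring V\<^esub> s) = a * u - b * s"
    by (simp add: a_minus_poly_ring del: poly_ring_simps(1))
  then show ?thesis by (simp add: loc_frac_def del: poly_ring_simps(1))
qed (simp add: loc_frac_def del: poly_ring_simps(1))

text \<open>Expanding a fraction by \<open>s\<close>. Both sides are sets of representatives, so
  annihilators have to be carried over in both directions.\<close>

lemma loc_frac_eq_if_mult:
  fixes P :: "(('v \<Rightarrow>\<^sub>0 nat) \<Rightarrow>\<^sub>0 'k::comm_ring_1) set"
  assumes P: "primeideal P (poly_ring V)"
    and f: "f \<in> carrier (poly_ring V)" and s: "s \<in> carrier (poly_ring V) - P"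
  shows "loc_frac (poly_ring V) P f 1 = loc_frac (poly_ring V) P (s * f) s"
proof -
  let ?R = "poly_ring V :: (('v \<Rightarrow>\<^sub>0 nat) \<Rightarrow>\<^sub>0 'k) ring"
  interpret primeideal P ?R by (rule P)
  have "(\<exists>q\<in>carrier ?R - P. q * (f * u - b) = 0) \<longleftrightarrow> (\<exists>q\<in>carrier ?R - P. q * (s * f * u - b * s) = 0)"
    for b u
  proof
    assume "\<exists>q\<in>carrier ?R - P. q * (f * u - b) = 0"
    then obtain q where "q \<in> carrier ?R - P" "q * (f * u - b) = 0" by blast
    moreover have "q * (s * f * u - b * s) = s * (q * (f * u - b))" for q by (simp add: algebra_simps)
    ultimately show "\<exists>q\<in>carrier ?R - P. q * (s * f * u - b * s) = 0" by force
  next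
    assume "\<exists>q\<in>carrier ?R - P. q * (s * f * u - b * s) = 0"
    then obtain q where q: "q \<in> carrier ?R - P" "q * (s * f * u - b * s) = 0" by blast
    \<comment> \<open>Towards the reduced fraction the annihilator becomes \<open>q * s\<close>,
      which is outside \<open>P\<close> because \<open>P\<close> is prime.\<close>
    have "q * s * (f * u - b) = q * (s * f * u - b * s)" by (simp add: algebra_simps)
    moreover have "q * s \<in> carrier ?R - P"
      using I_prime[of q s] q(1) s poly_ring_closed(1)[of q V s] by auto
    ultimately show "\<exists>q\<in>carrier ?R - P. q * (f * u - b) = 0" using q(2) by metis
  qed
  moreover have "1 \<in> carrier ?R" by simp
  ultimately show ?thesis
    using s by (auto simp: mem_loc_frac_poly_ring simp del: poly_ring_simps(1))
qed

text \<open>For one inclusion the primes of minimal covers suffice: a multiplier outside such a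
  prime has a term of weight 0 and cannot raise the least weight of \<open>f\<close>. For the other,
  every associated prime singles out a minimal cover, and the variables outside it serve as
  denominators.\<close>

lemma symbolic_power_edge_ideal:
  assumes G: "simple_graph V E"
  shows "symbolic_power (poly_ring V) (edge_ideal V E :: (('v \<Rightarrow>\<^sub>0 nat) \<Rightarrow>\<^sub>0 'k::idom) set) t =
    mon_ideal V (heavy V E t)"
proof -
  let ?R = "poly_ring V :: (('v \<Rightarrow>\<^sub>0 nat) \<Rightarrow>\<^sub>0 'k) ring"
  let ?I = "edge_ideal V E :: (('v \<Rightarrow>\<^sub>0 nat) \<Rightarrow>\<^sub>0 'k) set"
  let ?J = "mon_ideal V (edge_pow E t) :: (('v \<Rightarrow>\<^sub>0 nat) \<Rightarrow>\<^sub>0 'k) set"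
  have fin: "finite V" using G by (simp add: simple_graph_def)
  have sym: "symbolic_power ?R ?I t =
      {f \<in> carrier ?R. \<forall>P\<in>associated_primes ?R ?I. loc_frac ?R P f 1 \<in> loc_ideal ?R P ?J}"
    by (simp add: symbolic_power_def edge_ideal_power[OF G])
  show ?thesis
  proof
    show "symbolic_power ?R ?I t \<subseteq> mon_ideal V (heavy V E t)"
    proof
      fix f assume "f \<in> symbolic_power ?R ?I t"
      then have f: "f \<in> carrier ?R"
        and loc: "\<And>P. P \<in> associated_primes ?R ?I \<Longrightarrow> loc_frac ?R P f 1 \<in> loc_ideal ?R P ?J"
        unfolding sym by blast+
      have "t \<le> vertex_weight W a" if a: "a \<in> keys f" and W: "minimal_vertex_cover V E W" for a W
      proof -
        let ?P = "mon_ideal V {a. 1 \<le> vertex_weight W a} :: (('v \<Rightarrow>\<^sub>0 nat) \<Rightarrow>\<^sub>0 'k) set"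
        interpret primeideal ?P ?R by (rule primeideal_cover[OF fin])
        have "loc_frac ?R ?P f 1 \<in> loc_ideal ?R ?P ?J" by (rule loc[OF associated_prime_cover[OF G W]])
        then obtain g s where gs: "g \<in> ?J" "s \<in> carrier ?R - ?P" "loc_frac ?R ?P f 1 = loc_frac ?R ?P g s"
          unfolding loc_ideal_def by blast
        have one: "1 \<in> carrier ?R - ?P" by (auto simp: mon_ideal_def vertex_weight_def)
        then have "(f, 1) \<in> loc_frac ?R ?P f 1"
          using f by (auto simp: mem_loc_frac_poly_ring simp del: poly_ring_simps(1))
        \<comment> \<open>Reading the equality of classes at the representative
          \<open>(f, 1)\<close> yields an equation in the polynomial ring.\<close>
        then have "(f, 1) \<in> loc_frac ?R ?P g s" using gs(3) by simp
        then obtain q where q: "q \<in> carrier ?R - ?P" "q * (g - f * s) = 0"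
          using gs(2) by (auto simp: mem_loc_frac_poly_ring simp del: poly_ring_simps(1))
        have qs: "q * s \<in> carrier ?R" using q gs(2) by (intro poly_ring_closed(1)) auto
        have "q * s \<notin> ?P" using I_prime[of q s] q(1) gs(2) by auto
        then have "\<not> keys (q * s) \<subseteq> {a. 1 \<le> vertex_weight W a}"
          using qs unfolding mon_ideal_def by blast
        then obtain b where b: "b \<in> keys (q * s)" "vertex_weight W b = 0"
          unfolding subset_iff mem_Collect_eq not_all not_imp by (meson less_one not_le)
        obtain c d where cd: "c + d \<in> keys (f * (q * s))" "vertex_weight W c \<le> vertex_weight W a"
          "vertex_weight W d \<le> vertex_weight W b"
          using min_weight_term_mult[OF fin f qs vertex_weight_add[of W] a b(1)] by blast
        interpret J: ideal ?J ?R by (rule ideal_mon_ideal, erule edge_pow_up)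
        have "f * (q * s) = q * g" using q(2) by (simp add: algebra_simps)
        moreover have "q * g \<in> ?J" using J.I_l_closed[OF gs(1), of q] q(1) by simp
        ultimately have "c + d \<in> edge_pow E t" using cd(1) by (auto simp: mon_ideal_def)
        then have "t \<le> vertex_weight W (c + d)"
          using edge_pow_weight[OF fin] W by (auto simp: minimal_vertex_cover_def)
        then show ?thesis using cd b(2) by (simp add: vertex_weight_add)
      qed
      then show "f \<in> mon_ideal V (heavy V E t)"
        using f by (auto simp: mon_ideal_def heavy_iff_minimal[OF fin])
    qed
  next
    show "mon_ideal V (heavy V E t) \<subseteq> symbolic_power ?R ?I t"
    proof
      fix f :: "('v \<Rightarrow>\<^sub>0 nat) \<Rightarrow>\<^sub>0 'k" assume "f \<in> mon_ideal V (heavy V E t)"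
      then have f: "f \<in> carrier ?R" and keys_f: "keys f \<subseteq> heavy V E t" by (auto simp: mon_ideal_def)
      have "loc_frac ?R P f 1 \<in> loc_ideal ?R P ?J" if P: "P \<in> associated_primes ?R ?I" for P
      proof -
        let ?W = "{v \<in> V. var v \<in> P}"
        have prime: "primeideal P ?R" using P by (simp add: associated_primes_def)
        have W: "minimal_vertex_cover V E ?W" by (rule minimal_cover_of_associated_prime[OF G P])
        \<comment> \<open>The exponent \<open>t\<close> provides a partner outside the cover for
          each of the \<open>t\<close> edges to be packed.\<close>
        define m where "m = constant_exponent (V - ?W) t"
        define s :: "('v \<Rightarrow>\<^sub>0 nat) \<Rightarrow>\<^sub>0 'k" where "s = monomial m"
        have "keys m \<subseteq> V - ?W" unfolding m_def using fin by (intro keys_constant_exponent) auto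
        then have "s \<in> carrier ?R" by (auto simp: s_def monomial_def)
        moreover have "s \<notin> P"
          unfolding s_def m_def by (rule constant_exponent_notin_prime[OF prime]) (use fin in auto)
        ultimately have s: "s \<in> carrier ?R - P" by blast
        have "keys (s * f) \<subseteq> edge_pow E t"
        proof
          fix d assume "d \<in> keys (s * f)"
          then obtain a where d: "d = m + a" "a \<in> keys f"
            using keys_mult[of s f] by (auto simp: s_def monomial_def)
          show "d \<in> edge_pow E t"
          proof (rule edge_pow_if_weight[OF G W])
            have "t \<le> vertex_weight ?W a"
              using keys_f d(2) W by (auto simp: heavy_iff_minimal[OF fin])
            then show "t \<le> vertex_weight ?W d" by (simp add: d(1) vertex_weight_add)
            show "t \<le> lookup d z" if "z \<in> V - ?W" for z
              using that fin by (simp add: d(1) m_def lookup_add lookup_constant_exponent)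
          qed
        qed
        then have "s * f \<in> ?J" using poly_ring_closed(1)[of s V f] s f by (simp add: mon_ideal_def)
        then show ?thesis using s loc_frac_eq_if_mult[OF prime f s] unfolding loc_ideal_def by blast
      qed
      then show "f \<in> symbolic_power ?R ?I t" unfolding sym using f by blast
    qed
  qed
qed

theorem theorem6p3:
  fixes n t :: nat
    and V W :: "'v set"
    and E C :: "'v set set"
    and y u :: 'v
    and I :: "(('v \<Rightarrow>\<^sub>0 nat) \<Rightarrow>\<^sub>0 'k::alg_closed_field) set"
  assumes "n \<ge> 1"
    and "simple_graph V E" and "card V = 2 * n + 2" and "card E = 2 * n + 2"
    and "C \<subseteq> E" and "card C = 2 * n + 1"
    and "W \<subseteq> V" and "card W = 2 * n + 1" and "forms_cycle C W"
    and "V - W = {y}" and "u \<in> W" and "E - C = {{y, u}}"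
    and "I = edge_ideal V E"
    and "t \<ge> 1"
  shows "symbolic_power (poly_ring V) I t =
    (I [^]\<^bsub>ideals_set (poly_ring V)\<^esub> t) <+>\<^bsub>poly_ring V\<^esub> (Idl\<^bsub>poly_ring V\<^esub> (low_deg_monomials V E t))"
proof -
  let ?R = "poly_ring V :: (('v \<Rightarrow>\<^sub>0 nat) \<Rightarrow>\<^sub>0 'k) ring"
  interpret cring ?R by (rule cring_poly_ring)
  note G = \<open>simple_graph V E\<close>
  have fin: "finite V" using G by (simp add: simple_graph_def)
  obtain xs where xs: "distinct xs" "set xs = W" "C = cycle_edges xs"
    using \<open>forms_cycle C W\<close> unfolding forms_cycle_def cycle_edges_def by blast
  have "length xs = 2 * n + 1" using distinct_card[OF xs(1)] xs(2) \<open>card W = 2 * n + 1\<close> by simp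
  then have len: "odd (length xs)" by simp
  have V: "V = insert y (set xs)" "y \<notin> set xs"
    using \<open>V - W = {y}\<close> \<open>W \<subseteq> V\<close> xs(2) by auto
  have E: "E = insert {y, u} (cycle_edges xs)"
    using \<open>E - C = {{y, u}}\<close> \<open>C \<subseteq> E\<close> xs(3) by auto
  \<comment> \<open>The exponents of the generators of \<open>D(t)\<close>, with all covers in place
    of the minimal ones.\<close>
  let ?A = "{a. keys a \<subseteq> V \<and> total_deg a < 2 * t \<and> a \<in> heavy V E t}"
  let ?D = "{a + b | a b. a \<in> ?A}"
  have low: "low_deg_monomials V E t = (monomial ` ?A :: (('v \<Rightarrow>\<^sub>0 nat) \<Rightarrow>\<^sub>0 'k) set)"
    unfolding low_deg_monomials_def by (auto simp: heavy_iff_minimal[OF fin])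
  have D: "Idl\<^bsub>?R\<^esub> (low_deg_monomials V E t) = mon_ideal V ?D"
    unfolding low by (rule genideal_monomials) auto
  let ?M = "mon_ideal V (edge_pow E t) :: (('v \<Rightarrow>\<^sub>0 nat) \<Rightarrow>\<^sub>0 'k) set"
  let ?N = "mon_ideal V ?D :: (('v \<Rightarrow>\<^sub>0 nat) \<Rightarrow>\<^sub>0 'k) set"
  let ?S = "mon_ideal V (heavy V E t) :: (('v \<Rightarrow>\<^sub>0 nat) \<Rightarrow>\<^sub>0 'k) set"
  have M: "ideal ?M ?R" by (rule ideal_mon_ideal, erule edge_pow_up)
  have N: "ideal ?N ?R" by (rule ideal_multiples)
  have S: "ideal ?S ?R" by (rule ideal_mon_ideal, erule heavy_up)
  \<comment> \<open>The sum is generated by the union of its summands, so the remaining inclusion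
    can be checked on single terms.\<close>
  have union: "Idl\<^bsub>?R\<^esub> (?M \<union> ?N) = ?M <+>\<^bsub>?R\<^esub> ?N" by (rule union_genideal[OF M N])
  have carr: "?M \<union> ?N \<subseteq> carrier ?R" by (auto simp: mon_ideal_def)
  have "?S = Idl\<^bsub>?R\<^esub> (?M \<union> ?N)"
  proof
    show "?S \<subseteq> Idl\<^bsub>?R\<^esub> (?M \<union> ?N)"
    proof (rule mon_ideal_subset[OF genideal_ideal[OF carr]])
      fix a :: "'v \<Rightarrow>\<^sub>0 nat" and c :: 'k
      assume a: "a \<in> heavy V E t" "keys a \<subseteq> V"
      \<comment> \<open>A term of degree below \<open>2 * t\<close> is itself a multiple of a
        generator of \<open>D(t)\<close>; any other term is packed with \<open>t\<close> edges and
        lies in the ordinary power.\<close>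
      have "a \<in> edge_pow E t \<union> ?D"
      proof (cases "total_deg a < 2 * t")
        case True
        then have "a + 0 \<in> ?D" using a by blast
        then show ?thesis by simp
      next
        case False
        have "total_deg a \<le> vertex_weight V a"
          unfolding total_deg_def vertex_weight_def by (rule sum_mono2) (use fin a in auto)
        with False have deg: "2 * t \<le> vertex_weight V a" by simp
        have "a \<in> edge_pow E t"
          by (rule heavy_odd_cycle_with_pendant[OF G xs(1) len V _ E a(1) deg])
            (use \<open>u \<in> W\<close> xs(2) in auto)
        then show ?thesis by simp
      qed
      then have "single a c \<in> ?M \<union> ?N" using a(2) by (auto simp: mon_ideal_def)
      then show "single a c \<in> Idl\<^bsub>?R\<^esub> (?M \<union> ?N)" using genideal_self[OF carr] by blast
    qed
    have "edge_pow E t \<subseteq> heavy V E t" using edge_pow_weight[OF fin] by (auto simp: heavy_def)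
    moreover have "?D \<subseteq> heavy V E t" using heavy_up by blast
    ultimately have "?M \<union> ?N \<subseteq> ?S" unfolding mon_ideal_def by blast
    then show "Idl\<^bsub>?R\<^esub> (?M \<union> ?N) \<subseteq> ?S" by (rule genideal_minimal[OF S])
  qed
  then show ?thesis
    using union by (simp add: \<open>I = _\<close> symbolic_power_edge_ideal[OF G] edge_ideal_power[OF G] D)
qed

end
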